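(* Let $\Omega\subset\mathbb{C}^2$ be a smoothly bounded, pseudoconvex domain. Assume that $0\in b\Omega$ is a point of weak pseudoconvexity, and let $r$ be a smooth local defining function for $\Omega$ near $0$. Let $L$ be a nonvanishing holomorphic tangential vector field near $0$ and $\lambda:=H_r(L,L)|_{b\Omega}$. If $r_z(0)=r_{zz}(0)=0$, then $$(L\bar L\lambda)(0)>|(LL\lambda)(0)|$$ if and only if there exists a constant $\varepsilon>0$ such that $$H_r(L,L)(z,0)\ge\varepsilon|z|^2+o(|z|^2)\quad\text{as } z\to0.$$
   Context: Coordinates in $\mathbb{C}^2$ are $(z,w)$; subscripts denote partial derivatives. "Smooth" means $\mathcal{C}^\infty$; "smoothly bounded" means that $b\Omega$ is smooth. A smooth function $r\colon U\to\mathbb{R}$ is a local defining function for $\Omega$ near $p_0\in b\Omega$ if $U$ is an open neighborhood of $p_0$, $\Omega\cap U=\{r<0\}$, and $dr\ne0$ on $b\Omega\cap U$. A "holomorphic vector field" means a smooth vector field of type $(1,0)$; it is tangential if $Lr=0$ on $b\Omega$. With $(z^1,z^2)=(z,w)$, $H_f(A,B)=\sum_{j,k}\frac{\partial^2f}{\partial z^j\partial\bar z^k}A^j\overline{B^k}$ for $(1,0)$ vector fields $A,B$. $\Omega$ is pseudoconvex at $p\in b\Omega$ if $H_r(L,L)\ge0$ on $b\Omega$ near $p$ for all holomorphic tangential $L$; strictly pseudoconvex at $p$ if in addition the inequality is strict whenever $L$ is nonvanishing; weakly pseudoconvex at $p$ if pseudoconvex but not strictly pseudoconvex at $p$. $L\bar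 L\lambda=L(\bar L\lambda)$, $LL\lambda=L(L\lambda)$. *)

theory Defs
  imports "HOL-Analysis.Analysis" "HOL-Library.Landau_Symbols" "HOL-Library.Complex_Order"
begin

section \<open>Smooth functions\<close>

primrec times_diff_on :: "nat \<Rightarrow> 'a::real_normed_vector set \<Rightarrow> ('a \<Rightarrow> 'b::real_normed_vector) \<Rightarrow> bool"
where
  "times_diff_on 0 U f \<longleftrightarrow> continuous_on U f"
| "times_diff_on (Suc n) U f \<longleftrightarrow>
     (\<forall>x\<in>U. f differentiable (at x)) \<and>
     (\<forall>v. times_diff_on n U (\<lambda>x. frechet_derivative f (at x) v))"

text \<open>On an open set \<open>U\<close> of a finite-dimensional space, \<open>times_diff_on n U f\<close> says that \<open>f\<close> is of
  class \<open>C\<close>-\<open>n\<close>; derivatives are over the reals.\<close>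

definition smooth_on :: "'a::euclidean_space set \<Rightarrow> ('a \<Rightarrow> 'b::real_normed_vector) \<Rightarrow> bool" where
  "smooth_on U f \<longleftrightarrow> (\<forall>n. times_diff_on n U f)"


section \<open>Wirtinger derivatives and vector fields of type (1,0)\<close>

type_synonym C2 = "complex \<times> complex"

text \<open>The coefficients of a real-linear map \<open>D\<close> with respect to \<open>dz, dw\<close> and their conjugates.\<close>

definition coef_z :: "(C2 \<Rightarrow> complex) \<Rightarrow> complex" where
  "coef_z D = (D (1, 0) - \<i> * D (\<i>, 0)) / 2"

definition coef_w :: "(C2 \<Rightarrow> complex) \<Rightarrow> complex" where
  "coef_w D = (D (0, 1) - \<i> * D (0, \<i>)) / 2"

definition coef_zbar :: "(C2 \<Rightarrow> complex) \<Rightarrow> complex" where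
  "coef_zbar D = (D (1, 0) + \<i> * D (\<i>, 0)) / 2"

definition coef_wbar :: "(C2 \<Rightarrow> complex) \<Rightarrow> complex" where
  "coef_wbar D = (D (0, 1) + \<i> * D (0, \<i>)) / 2"

definition d_z :: "(C2 \<Rightarrow> complex) \<Rightarrow> C2 \<Rightarrow> complex" where
  "d_z f p = coef_z (frechet_derivative f (at p))"

definition d_w :: "(C2 \<Rightarrow> complex) \<Rightarrow> C2 \<Rightarrow> complex" where
  "d_w f p = coef_w (frechet_derivative f (at p))"

definition d_zbar :: "(C2 \<Rightarrow> complex) \<Rightarrow> C2 \<Rightarrow> complex" where
  "d_zbar f p = coef_zbar (frechet_derivative f (at p))"

definition d_wbar :: "(C2 \<Rightarrow> complex) \<Rightarrow> C2 \<Rightarrow> complex" where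
  "d_wbar f p = coef_wbar (frechet_derivative f (at p))"

text \<open>A vector field of type (1,0) is given by its pair \<open>L\<close> of coefficient functions with respect to
  the coordinate fields in \<open>z\<close> and \<open>w\<close>. \<open>vf L S f\<close> and \<open>vf_bar L S f\<close> are the derivatives of \<open>f\<close>
  along \<open>L\<close> and along the conjugate of \<open>L\<close>, where \<open>f\<close> is regarded as a function on \<open>S\<close> only.
  For \<open>S = UNIV\<close> this is the usual derivative. If \<open>S\<close> is a smooth real hypersurface,
  \<open>frechet_derivative f (at p within S)\<close> is not unique as a linear map, but its values on vectors
  tangent to \<open>S\<close> are; hence for \<open>L\<close> tangential to \<open>S\<close> the results are the intrinsic
  tangential derivatives of \<open>f\<close>, depending only on the values of \<open>f\<close> on \<open>S\<close>.\<close>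

definition vf :: "(C2 \<Rightarrow> C2) \<Rightarrow> C2 set \<Rightarrow> (C2 \<Rightarrow> complex) \<Rightarrow> C2 \<Rightarrow> complex" where
  "vf L S f p = (let D = frechet_derivative f (at p within S)
     in fst (L p) * coef_z D + snd (L p) * coef_w D)"

definition vf_bar :: "(C2 \<Rightarrow> C2) \<Rightarrow> C2 set \<Rightarrow> (C2 \<Rightarrow> complex) \<Rightarrow> C2 \<Rightarrow> complex" where
  "vf_bar L S f p = (let D = frechet_derivative f (at p within S)
     in cnj (fst (L p)) * coef_zbar D + cnj (snd (L p)) * coef_wbar D)"

text \<open>The complex Hessian \<open>H_f(A,B)\<close>. It is complex-valued; inequalities below use the order of
  \<open>HOL-Library.Complex_Order\<close>, in which \<open>x \<le> y\<close> means that \<open>y - x\<close> is real and nonnegative.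
  For smooth real-valued \<open>r\<close> the values of \<open>H_r(L,L)\<close> are real.\<close>

definition hess :: "(C2 \<Rightarrow> complex) \<Rightarrow> (C2 \<Rightarrow> C2) \<Rightarrow> (C2 \<Rightarrow> C2) \<Rightarrow> C2 \<Rightarrow> complex" where
  "hess f A B p =
     d_z (d_zbar f) p * fst (A p) * cnj (fst (B p)) +
     d_z (d_wbar f) p * fst (A p) * cnj (snd (B p)) +
     d_w (d_zbar f) p * snd (A p) * cnj (fst (B p)) +
     d_w (d_wbar f) p * snd (A p) * cnj (snd (B p))"

abbreviation cplx :: "(C2 \<Rightarrow> real) \<Rightarrow> C2 \<Rightarrow> complex" where
  "cplx r \<equiv> (\<lambda>p. complex_of_real (r p))"


section \<open>Domains and pseudoconvexity\<close>

definition local_defining :: "C2 set \<Rightarrow> C2 \<Rightarrow> C2 set \<Rightarrow> (C2 \<Rightarrow> real) \<Rightarrow> bool" where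
  "local_defining \<Omega> p U r \<longleftrightarrow>
     p \<in> frontier \<Omega> \<and> open U \<and> p \<in> U \<and> smooth_on U r \<and>
     \<Omega> \<inter> U = {q \<in> U. r q < 0} \<and>
     (\<forall>q \<in> frontier \<Omega> \<inter> U. frechet_derivative r (at q) \<noteq> (\<lambda>v. 0))"

text \<open>Boundedness of \<open>\<Omega>\<close> is not part of being smoothly bounded.\<close>

definition smoothly_bounded :: "C2 set \<Rightarrow> bool" where
  "smoothly_bounded \<Omega> \<longleftrightarrow> (\<forall>p \<in> frontier \<Omega>. \<exists>U r. local_defining \<Omega> p U r)"

text \<open>\<open>L\<close> is a holomorphic (that is, smooth of type (1,0)) tangential vector field on the open
  neighborhood \<open>V\<close> of \<open>p\<close>, where \<open>r\<close> is defined on \<open>U\<close>.\<close>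

definition holo_tangential ::
  "C2 set \<Rightarrow> C2 \<Rightarrow> C2 set \<Rightarrow> (C2 \<Rightarrow> real) \<Rightarrow> C2 set \<Rightarrow> (C2 \<Rightarrow> C2) \<Rightarrow> bool" where
  "holo_tangential \<Omega> p U r V L \<longleftrightarrow>
     open V \<and> p \<in> V \<and> smooth_on V L \<and>
     (\<forall>q \<in> frontier \<Omega> \<inter> U \<inter> V. vf L UNIV (cplx r) q = 0)"

definition nonvanishing_on :: "C2 set \<Rightarrow> (C2 \<Rightarrow> C2) \<Rightarrow> bool" where
  "nonvanishing_on V L \<longleftrightarrow> (\<forall>q \<in> V. L q \<noteq> 0)"

text \<open>The following conditions do not depend on the choice of the local defining function.\<close>

definition pseudoconvex_at :: "C2 set \<Rightarrow> C2 \<Rightarrow> bool" where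
  "pseudoconvex_at \<Omega> p \<longleftrightarrow> (\<exists>U r. local_defining \<Omega> p U r \<and>
     (\<forall>V L. holo_tangential \<Omega> p U r V L \<longrightarrow>
        (\<forall>\<^sub>F q in nhds p. q \<in> frontier \<Omega> \<longrightarrow> 0 \<le> hess (cplx r) L L q)))"

definition strictly_pseudoconvex_at :: "C2 set \<Rightarrow> C2 \<Rightarrow> bool" where
  "strictly_pseudoconvex_at \<Omega> p \<longleftrightarrow> pseudoconvex_at \<Omega> p \<and>
     (\<exists>U r. local_defining \<Omega> p U r \<and>
     (\<forall>V L. holo_tangential \<Omega> p U r V L \<and> nonvanishing_on V L \<longrightarrow>
        (\<forall>\<^sub>F q in nhds p. q \<in> frontier \<Omega> \<longrightarrow> 0 < hess (cplx r) L L q)))"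

definition weakly_pseudoconvex_at :: "C2 set \<Rightarrow> C2 \<Rightarrow> bool" where
  "weakly_pseudoconvex_at \<Omega> p \<longleftrightarrow> pseudoconvex_at \<Omega> p \<and> \<not> strictly_pseudoconvex_at \<Omega> p"

definition pseudoconvex_domain :: "C2 set \<Rightarrow> bool" where
  "pseudoconvex_domain \<Omega> \<longleftrightarrow>
     open \<Omega> \<and> connected \<Omega> \<and> \<Omega> \<noteq> {} \<and> (\<forall>p \<in> frontier \<Omega>. pseudoconvex_at \<Omega> p)"

end

theory Submission
  imports Defs
begin

text \<open>The Levi form is a quarter of the sum of the real Hessian of \<open>r\<close> in the directions \<open>L\<close> and
  \<open>\<i> L\<close>, and on complex tangent vectors it only changes by a positive factor when \<open>r\<close> is replaced by
  another defining function. Hence \<open>F = H\<^sub>r(L,L)\<close> is nonnegative on the boundary and vanishes at \<open>0\<close>, so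
  its differential vanishes on the tangent space there. Weak pseudoconvexity and \<open>r\<^sub>z\<^sub>z(0) = 0\<close> make the
  real Hessian of \<open>r\<close> vanish on the complex tangent space at \<open>0\<close>; differentiating the tangency relation
  then shows that the derivatives of \<open>L\<close> at \<open>0\<close> in complex tangential directions are tangential. So the
  first-order terms drop out of \<open>(L L' \<lambda>)(0)\<close> and \<open>(L L \<lambda>)(0)\<close>, with \<open>L'\<close> the conjugate of \<open>L\<close>;
  what remains are the two Wirtinger components of the real Hessian of \<open>F\<close> restricted to the complex tangent line. The inequality between
  them is positive definiteness of this plane quadratic form; by Taylor's
  formula half of the form is the leading part of \<open>F(z, 0)\<close>.\<close>

section \<open>Calculus of smooth functions\<close>

text \<open>In the closure lemmas below, the derivative of a sum, a linear image or a product is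
  given by its formula only at points of \<open>U\<close>; this carries the induction hypothesis
  from the formula over to \<open>frechet_derivative\<close>. Openness of \<open>U\<close> makes the
  derivative at a point depend on values in \<open>U\<close> alone.\<close>

lemma times_diff_on_cong:
  assumes "open U" and "\<And>x. x \<in> U \<Longrightarrow> f x = g x" and "times_diff_on n U f"
  shows "times_diff_on n U g"
  using assms(2,3)
proof (induction n arbitrary: f g)
  case 0
  then show ?case using continuous_on_cong[OF refl, of U f g] by auto
next
  case (Suc n)
  have diff: "f differentiable (at x)" if "x \<in> U" for x
    using Suc.prems that by simp
  have "g differentiable (at x)" if "x \<in> U" for x
    using diff[OF that] Suc.prems(1) assms(1) that
    by (meson differentiable_def has_derivative_transform_within_open)
  moreover have "times_diff_on n U (\<lambda>x. frechet_derivative g (at x) v)" for v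
  proof (rule Suc.IH)
    show "times_diff_on n U (\<lambda>x. frechet_derivative f (at x) v)"
      using Suc.prems by simp
    show "frechet_derivative f (at x) v = frechet_derivative g (at x) v" if "x \<in> U" for x
      using frechet_derivative_transform_within_open[OF diff[OF that] assms(1) that, of g]
        Suc.prems(1) by simp
  qed
  ultimately show ?case by simp
qed

lemma times_diff_on_SucD: "times_diff_on (Suc n) U f \<Longrightarrow> times_diff_on n U f"
proof (induction n arbitrary: f)
  case 0
  then show ?case
    by (auto intro!: continuous_at_imp_continuous_on differentiable_imp_continuous_within)
next
  case (Suc n)
  then show ?case by (metis times_diff_on.simps(2))
qed

lemma times_diff_on_subset: "times_diff_on n U f \<Longrightarrow> V \<subseteq> U \<Longrightarrow> times_diff_on n V f"
  by (induction n arbitrary: f) (auto intro: continuous_on_subset)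

lemma times_diff_on_add:
  assumes "open U" and "times_diff_on n U f" and "times_diff_on n U g"
  shows "times_diff_on n U (\<lambda>x. f x + g x)"
  using assms(2,3)
proof (induction n arbitrary: f g)
  case 0
  then show ?case by (simp add: continuous_on_add)
next
  case (Suc n)
  have d: "((\<lambda>x. f x + g x) has_derivative
      (\<lambda>v. frechet_derivative f (at x) v + frechet_derivative g (at x) v)) (at x)"
    if "x \<in> U" for x
    using Suc.prems that by (auto intro!: has_derivative_add simp flip: frechet_derivative_works)
  have "times_diff_on n U (\<lambda>x. frechet_derivative (\<lambda>x. f x + g x) (at x) v)" for v
  proof (rule times_diff_on_cong[OF assms(1)])
    show "times_diff_on n U (\<lambda>x. frechet_derivative f (at x) v + frechet_derivative g (at x) v)"
      using Suc.prems by (intro Suc.IH) auto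
    show "frechet_derivative f (at x) v + frechet_derivative g (at x) v
        = frechet_derivative (\<lambda>x. f x + g x) (at x) v" if "x \<in> U" for x
      using fun_cong[OF frechet_derivative_at[OF d[OF that]], of v] by simp
  qed
  then show ?case using d unfolding times_diff_on.simps differentiable_def by blast
qed

lemma times_diff_on_bounded_linear:
  assumes "open U" and "times_diff_on n U f" and T: "bounded_linear T"
  shows "times_diff_on n U (\<lambda>x. T (f x))"
  using assms(2)
proof (induction n arbitrary: f)
  case 0
  then show ?case by (simp add: bounded_linear.continuous_on[OF T])
next
  case (Suc n)
  have d: "((\<lambda>x. T (f x)) has_derivative (\<lambda>v. T (frechet_derivative f (at x) v))) (at x)"
    if "x \<in> U" for x
    using Suc.prems that
    by (auto intro!: bounded_linear.has_derivative[OF T] simp flip: frechet_derivative_works)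
  have "times_diff_on n U (\<lambda>x. frechet_derivative (\<lambda>x. T (f x)) (at x) v)" for v
  proof (rule times_diff_on_cong[OF assms(1)])
    show "times_diff_on n U (\<lambda>x. T (frechet_derivative f (at x) v))"
      using Suc.prems by (intro Suc.IH) auto
    show "T (frechet_derivative f (at x) v) = frechet_derivative (\<lambda>x. T (f x)) (at x) v"
      if "x \<in> U" for x
      using fun_cong[OF frechet_derivative_at[OF d[OF that]], of v] by simp
  qed
  then show ?case using d unfolding times_diff_on.simps differentiable_def by blast
qed

lemma times_diff_on_bilinear:
  assumes "open U" and "times_diff_on n U f" and "times_diff_on n U g"
    and B: "bounded_bilinear pr"
  shows "times_diff_on n U (\<lambda>x. pr (f x) (g x))"
  using assms(2,3)
proof (induction n arbitrary: f g)
  case 0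
  then show ?case by (simp add: bounded_bilinear.continuous_on[OF B])
next
  case (Suc n)
  have d: "((\<lambda>x. pr (f x) (g x)) has_derivative
      (\<lambda>v. pr (f x) (frechet_derivative g (at x) v) + pr (frechet_derivative f (at x) v) (g x))) (at x)"
    if "x \<in> U" for x
    using Suc.prems that
    by (auto intro!: bounded_bilinear.FDERIV[OF B] simp flip: frechet_derivative_works)
  have "times_diff_on n U (\<lambda>x. frechet_derivative (\<lambda>x. pr (f x) (g x)) (at x) v)" for v
  proof (rule times_diff_on_cong[OF assms(1)])
    \<comment> \<open>Each summand of the product rule keeps one undifferentiated factor, so the
      induction hypothesis needs \<open>f\<close> and \<open>g\<close> themselves at the lower order
      \<open>n\<close>.\<close>
    show "times_diff_on n U (\<lambda>x. pr (f x) (frechet_derivative g (at x) v)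
        + pr (frechet_derivative f (at x) v) (g x))"
      using Suc.prems times_diff_on_SucD[OF Suc.prems(1)] times_diff_on_SucD[OF Suc.prems(2)]
      by (intro times_diff_on_add[OF assms(1)] Suc.IH) auto
    show "pr (f x) (frechet_derivative g (at x) v) + pr (frechet_derivative f (at x) v) (g x)
        = frechet_derivative (\<lambda>x. pr (f x) (g x)) (at x) v" if "x \<in> U" for x
      using fun_cong[OF frechet_derivative_at[OF d[OF that]], of v] by simp
  qed
  then show ?case using d unfolding times_diff_on.simps differentiable_def by blast
qed

lemma smooth_on_deriv: "smooth_on U f \<Longrightarrow> smooth_on U (\<lambda>x. frechet_derivative f (at x) v)"
  unfolding smooth_on_def by (metis times_diff_on.simps(2))

lemma smooth_on_has_derivative:
  "smooth_on U f \<Longrightarrow> x \<in> U \<Longrightarrow> (f has_derivative frechet_derivative f (at x)) (at x)"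
  unfolding smooth_on_def by (metis times_diff_on.simps(2) frechet_derivative_works)

lemma smooth_on_imp_continuous_on: "smooth_on U f \<Longrightarrow> continuous_on U f"
  unfolding smooth_on_def by (metis times_diff_on.simps(1))

lemma smooth_on_subset: "smooth_on U f \<Longrightarrow> V \<subseteq> U \<Longrightarrow> smooth_on V f"
  unfolding smooth_on_def using times_diff_on_subset by blast

lemma smooth_on_add:
  "open U \<Longrightarrow> smooth_on U f \<Longrightarrow> smooth_on U g \<Longrightarrow> smooth_on U (\<lambda>x. f x + g x)"
  unfolding smooth_on_def using times_diff_on_add by blast

lemma smooth_on_bounded_linear:
  "open U \<Longrightarrow> smooth_on U f \<Longrightarrow> bounded_linear T \<Longrightarrow> smooth_on U (\<lambda>x. T (f x))"
  unfolding smooth_on_def using times_diff_on_bounded_linear by blast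

lemma smooth_on_mult:
  fixes f g :: "'a::euclidean_space \<Rightarrow> 'b::real_normed_algebra"
  shows "open U \<Longrightarrow> smooth_on U f \<Longrightarrow> smooth_on U g \<Longrightarrow> smooth_on U (\<lambda>x. f x * g x)"
  unfolding smooth_on_def using times_diff_on_bilinear[OF _ _ _ bounded_bilinear_mult] by blast

section \<open>Second derivatives\<close>

text \<open>The outer direction comes first. Linearity in \<open>u\<close> is then part of being a
  derivative, while linearity in \<open>v\<close> and symmetry remain to be proved.\<close>

definition second_deriv :: "('a::euclidean_space \<Rightarrow> real) \<Rightarrow> 'a \<Rightarrow> 'a \<Rightarrow> 'a \<Rightarrow> real" where
  "second_deriv f p u v = frechet_derivative (\<lambda>x. frechet_derivative f (at x) v) (at p) u"

lemma has_second_deriv: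
  assumes "smooth_on U f" and "p \<in> U"
  shows "((\<lambda>x. frechet_derivative f (at x) v) has_derivative (\<lambda>u. second_deriv f p u v)) (at p)"
  unfolding second_deriv_def
  using smooth_on_has_derivative[OF smooth_on_deriv[OF assms(1)] assms(2)] by simp

lemma linear_frechet_derivative: "smooth_on U f \<Longrightarrow> x \<in> U \<Longrightarrow> linear (frechet_derivative f (at x))"
  using has_derivative_linear smooth_on_has_derivative by blast

text \<open>Linearity in the second argument is inherited from the first derivatives at the points
  near \<open>p\<close>, by uniqueness of the derivative at \<open>p\<close>. Boundedness is
  automatic in finite dimension.\<close>

lemma bounded_bilinear_second_deriv:
  assumes "smooth_on U f" and "open U" and "p \<in> U"
  shows "bounded_bilinear (second_deriv f p)"
proof -
  have 1: "linear (\<lambda>u. second_deriv f p u v)" for v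
    using has_second_deriv[OF assms(1,3)] has_derivative_linear by blast
  have 2: "linear (\<lambda>v. second_deriv f p u v)" for u
  proof (rule linearI)
    fix v w
    have "((\<lambda>x. frechet_derivative f (at x) (v + w)) has_derivative
        (\<lambda>u. second_deriv f p u v + second_deriv f p u w)) (at p)"
      by (rule has_derivative_transform_within_open[OF has_derivative_add[OF
            has_second_deriv[OF assms(1,3)] has_second_deriv[OF assms(1,3)]] assms(2,3)])
        (simp add: linear_add[OF linear_frechet_derivative[OF assms(1)]])
    with has_second_deriv[OF assms(1,3), of "v + w"]
    show "second_deriv f p u (v + w) = second_deriv f p u v + second_deriv f p u w"
      by (metis has_derivative_unique)
  next
    fix c v
    have "((\<lambda>x. frechet_derivative f (at x) (c *\<^sub>R v)) has_derivative
        (\<lambda>u. c *\<^sub>R second_deriv f p u v)) (at p)"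
      by (rule has_derivative_transform_within_open[OF has_derivative_scaleR_right[OF
            has_second_deriv[OF assms(1,3)]] assms(2,3)])
        (simp add: linear_scale[OF linear_frechet_derivative[OF assms(1)]])
    with has_second_deriv[OF assms(1,3), of "c *\<^sub>R v"]
    show "second_deriv f p u (c *\<^sub>R v) = c *\<^sub>R second_deriv f p u v"
      by (metis has_derivative_unique)
  qed
  show ?thesis
    using 1 2 bilinear_conv_bounded_bilinear unfolding bilinear_def by blast
qed

text \<open>Differentiability of the first derivative is available for one fixed direction at a
  time. A common radius for the finitely many basis vectors, together with linearity in
  \<open>h\<close>, makes the estimate uniform in \<open>h\<close>.\<close>

lemma deriv_increment_bound:
  assumes "smooth_on U f" and "open U" and "p \<in> U" and "e > 0"
  obtains d where "d > 0" and "ball p d \<subseteq> U"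
    and "\<And>k h. norm k < d \<Longrightarrow> \<bar>frechet_derivative f (at (p + k)) h
        - frechet_derivative f (at p) h - second_deriv f p k h\<bar> \<le> e * norm k * norm h"
proof -
  define E where "E k h = frechet_derivative f (at (p + k)) h
    - frechet_derivative f (at p) h - second_deriv f p k h" for k h
  \<comment> \<open>Compensates for the sum over the basis, whose \<open>DIM('a)\<close> terms are
    each at most \<open>e' * norm k * norm h\<close>.\<close>
  define e' where "e' = e / real DIM('a)"
  have e': "e' > 0" using assms(4) by (simp add: e'_def)
  have "\<forall>\<^sub>F k in nhds 0. \<bar>E k b\<bar> \<le> e' * norm k" for b
  proof -
    obtain d where "d > 0" and d: "\<And>y. norm (y - p) < d \<Longrightarrow>
        norm (frechet_derivative f (at y) b - frechet_derivative f (at p) b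
          - second_deriv f p (y - p) b) \<le> e' * norm (y - p)"
      using has_second_deriv[OF assms(1,3), of b] e' unfolding has_derivative_at_alt by blast
    have "\<bar>E k b\<bar> \<le> e' * norm k" if "dist k 0 < d" for k
      using d[of "p + k"] that by (simp add: E_def)
    with \<open>d > 0\<close> show ?thesis unfolding eventually_nhds_metric by blast
  qed
  then have "\<forall>\<^sub>F k in nhds 0. \<forall>b\<in>Basis. \<bar>E k b\<bar> \<le> e' * norm k"
    by (intro eventually_ball_finite) auto
  then obtain d1 where d1: "d1 > 0" "\<And>k b. norm k < d1 \<Longrightarrow> b \<in> Basis \<Longrightarrow> \<bar>E k b\<bar> \<le> e' * norm k"
    unfolding eventually_nhds_metric by auto
  obtain d2 where d2: "d2 > 0" "ball p d2 \<subseteq> U" using assms(2,3) openE by blast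
  have "\<bar>E k h\<bar> \<le> e * norm k * norm h" if k: "norm k < min d1 d2" for k h
  proof -
    have "p + k \<in> U" using d2 k by (auto simp: subset_iff dist_norm)
    then have lin: "linear (E k)"
      unfolding E_def using linear_frechet_derivative[OF assms(1)] assms(3)
        bounded_linear.linear[OF bounded_bilinear.bounded_linear_right[OF
            bounded_bilinear_second_deriv[OF assms(1-3)]]]
      by (intro linear_compose_sub) auto
    have "E k h = E k (\<Sum>b\<in>Basis. (h \<bullet> b) *\<^sub>R b)" by (simp only: euclidean_representation)
    also have "\<dots> = (\<Sum>b\<in>Basis. (h \<bullet> b) * E k b)"
      by (simp only: linear_sum[OF lin] linear_scale[OF lin] real_scaleR_def)
    finally have "\<bar>E k h\<bar> \<le> (\<Sum>b\<in>Basis. \<bar>(h \<bullet> b) * E k b\<bar>)" by simp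
    also have "\<dots> \<le> (\<Sum>b\<in>(Basis :: 'a set). norm h * (e' * norm k))"
      by (rule sum_mono) (use d1(2) k Basis_le_norm e' in \<open>auto simp: abs_mult intro!: mult_mono\<close>)
    finally show ?thesis by (simp add: e'_def mult_ac)
  qed
  moreover have "ball p (min d1 d2) \<subseteq> U" using d2(2) by auto
  ultimately show ?thesis using d1(1) d2(1) by (intro that[of "min d1 d2"]) (auto simp: E_def)
qed

section \<open>Taylor's formula of order two and symmetry of the second derivative\<close>

lemma DERIV_along_line:
  fixes f :: "'a::real_normed_vector \<Rightarrow> real"
  assumes "(f has_derivative D) (at (p + s *\<^sub>R h))"
  shows "((\<lambda>s. f (p + s *\<^sub>R h)) has_real_derivative D h) (at s)"
proof -
  have "((\<lambda>s. p + s *\<^sub>R h) has_derivative (\<lambda>x. x *\<^sub>R h)) (at s)"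
    by (auto intro!: derivative_eq_intros)
  from has_derivative_compose[OF this assms]
  show ?thesis
    unfolding has_field_derivative_def
    using linear_scale[OF has_derivative_linear[OF assms]] by (simp add: mult_commute_abs)
qed

lemma second_order_Taylor:
  assumes "smooth_on U f" and "open U" and "p \<in> U" and "e > 0"
  obtains d where "d > 0" and "\<And>h. norm h < d \<Longrightarrow> \<bar>f (p + h) - f p
      - frechet_derivative f (at p) h - second_deriv f p h h / 2\<bar> \<le> e * (norm h)\<^sup>2"
proof -
  obtain d where d: "d > 0" "ball p d \<subseteq> U"
    and b: "\<And>k h. norm k < d \<Longrightarrow> \<bar>frechet_derivative f (at (p + k)) h
        - frechet_derivative f (at p) h - second_deriv f p k h\<bar> \<le> e * norm k * norm h"
    using deriv_increment_bound[OF assms] by blast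
  interpret B: bounded_bilinear "second_deriv f p"
    by (rule bounded_bilinear_second_deriv[OF assms(1-3)])
  have "\<bar>f (p + h) - f p - frechet_derivative f (at p) h - second_deriv f p h h / 2\<bar>
      \<le> e * (norm h)\<^sup>2" if h: "norm h < d" for h
  proof -
    \<comment> \<open>The restriction of \<open>f\<close> to the segment minus its linear and
      quadratic Taylor terms; the derivative of \<open>\<psi>\<close> is exactly the increment error
      bounded by \<open>b\<close>, so one use of the mean value theorem suffices.\<close>
    define \<psi> where "\<psi> s = f (p + s *\<^sub>R h) - s * frechet_derivative f (at p) h
        - s\<^sup>2 * (second_deriv f p h h / 2)" for s
    have "DERIV \<psi> s :> frechet_derivative f (at (p + s *\<^sub>R h)) h
        - frechet_derivative f (at p) h - second_deriv f p (s *\<^sub>R h) h"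
      if "0 \<le> s" "s \<le> 1" for s
    proof -
      have "norm (s *\<^sub>R h) < d"
        using h that mult_left_le_one_le[of "norm h" s] by simp
      then have "p + s *\<^sub>R h \<in> U" using d by (auto simp: subset_iff dist_norm)
      from DERIV_along_line[OF smooth_on_has_derivative[OF assms(1) this]]
      show ?thesis unfolding \<psi>_def
        by (auto intro!: derivative_eq_intros simp: B.scaleR_left)
    qed
    from MVT2[of 0 1 \<psi>, OF zero_less_one this]
    obtain s where s: "0 < s" "s < 1" and "\<psi> 1 - \<psi> 0 = frechet_derivative f (at (p + s *\<^sub>R h)) h
        - frechet_derivative f (at p) h - second_deriv f p (s *\<^sub>R h) h"
      by auto
    moreover have "norm (s *\<^sub>R h) \<le> norm h"
      using s mult_left_le_one_le[of "norm h" s] by simp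
    ultimately have "\<bar>\<psi> 1 - \<psi> 0\<bar> \<le> e * norm (s *\<^sub>R h) * norm h"
      using b[of "s *\<^sub>R h" h] h by simp
    also have "\<dots> \<le> e * norm h * norm h"
      using \<open>norm (s *\<^sub>R h) \<le> norm h\<close> assms(4) by (intro mult_mono) auto
    finally show ?thesis by (simp add: \<psi>_def power2_eq_square mult_ac)
  qed
  with d that show ?thesis by blast
qed

text \<open>The second difference is unchanged when \<open>u\<close> and \<open>v\<close> are
  exchanged, which is what yields symmetry. It is an increment over \<open>[0, t]\<close> of a
  difference of two restrictions to lines in direction \<open>v\<close>, so the mean value theorem
  reduces it to increments of the first derivative.\<close>

lemma second_difference_bound:
  assumes "smooth_on U f" and "open U" and "p \<in> U" and "e > 0"
  obtains d where "d > 0" and "\<And>t. 0 < t \<Longrightarrow> t < d \<Longrightarrow>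
    \<bar>f (p + t *\<^sub>R (u + v)) - f (p + t *\<^sub>R u) - f (p + t *\<^sub>R v) + f p - t\<^sup>2 * second_deriv f p u v\<bar>
      \<le> e * t\<^sup>2"
proof -
  \<comment> \<open>The errors \<open>A\<close> and \<open>A'\<close> below contribute
    \<open>norm u + norm v\<close> and \<open>norm v\<close>, each times \<open>norm v\<close>;
    adding 1 keeps the divisor positive.\<close>
  define M where "M = (norm u + 2 * norm v) * norm v + 1"
  have M: "M > 0" by (simp add: M_def add_nonneg_pos)
  define e' where "e' = e / M"
  have e': "e' > 0" using M assms(4) by (simp add: e'_def)
  obtain d where d: "d > 0" "ball p d \<subseteq> U"
    and b: "\<And>k h. norm k < d \<Longrightarrow> \<bar>frechet_derivative f (at (p + k)) h
        - frechet_derivative f (at p) h - second_deriv f p k h\<bar> \<le> e' * norm k * norm h"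
    using deriv_increment_bound[OF assms(1-3) e'] by blast
  interpret B: bounded_bilinear "second_deriv f p"
    by (rule bounded_bilinear_second_deriv[OF assms(1-3)])
  \<comment> \<open>Keeps all four corners of the parallelogram, and the segments in direction
    \<open>v\<close>, within distance \<open>d\<close> of \<open>p\<close>.\<close>
  define d' where "d' = d / (norm u + norm v + 1)"
  have "d' > 0" using d by (simp add: d'_def add_nonneg_pos)
  moreover have "\<bar>f (p + t *\<^sub>R (u + v)) - f (p + t *\<^sub>R u) - f (p + t *\<^sub>R v) + f p
      - t\<^sup>2 * second_deriv f p u v\<bar> \<le> e * t\<^sup>2" if t: "0 < t" "t < d'" for t
  proof -
    have td: "t * (norm u + norm v) < d"
    proof -
      have "t * (norm u + norm v + 1) < d"
        using t by (simp add: d'_def pos_less_divide_eq add_nonneg_pos)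
      then show ?thesis using t by (simp add: algebra_simps)
    qed
    define \<psi> where "\<psi> s = f ((p + t *\<^sub>R u) + s *\<^sub>R v) - f (p + s *\<^sub>R v)" for s
    have nb: "norm (s *\<^sub>R v) \<le> t * norm v" "norm (t *\<^sub>R u + s *\<^sub>R v) \<le> t * (norm u + norm v)"
      "norm (s *\<^sub>R v) < d" "norm (t *\<^sub>R u + s *\<^sub>R v) < d" if "0 \<le> s" "s \<le> t" for s
    proof -
      show 1: "norm (s *\<^sub>R v) \<le> t * norm v" using that by (simp add: mult_right_mono)
      show 2: "norm (t *\<^sub>R u + s *\<^sub>R v) \<le> t * (norm u + norm v)"
        using norm_triangle_ineq[of "t *\<^sub>R u" "s *\<^sub>R v"] 1 t by (simp add: algebra_simps)
      show "norm (s *\<^sub>R v) < d" using 1 td t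
        by (smt (verit) mult_nonneg_nonneg norm_ge_zero ring_class.ring_distribs(1))
      show "norm (t *\<^sub>R u + s *\<^sub>R v) < d" using 2 td by simp
    qed
    have "DERIV \<psi> s :> frechet_derivative f (at (p + (t *\<^sub>R u + s *\<^sub>R v))) v
        - frechet_derivative f (at (p + s *\<^sub>R v)) v" if "0 \<le> s" "s \<le> t" for s
    proof -
      have inU: "p + k \<in> U" if "norm k < d" for k
        using d(2) that by (auto simp: subset_iff dist_norm)
      have "p + s *\<^sub>R v \<in> U" "(p + t *\<^sub>R u) + s *\<^sub>R v \<in> U"
        using inU[OF nb(3)[OF that]] inU[OF nb(4)[OF that]] by (simp_all add: add.assoc)
      from this[THEN DERIV_along_line[OF smooth_on_has_derivative[OF assms(1)]]]
      show ?thesis unfolding \<psi>_def by (auto intro!: derivative_eq_intros simp: add.assoc)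
    qed
    from MVT2[of 0 t \<psi>, OF t(1) this]
    obtain s where s: "0 < s" "s < t" and eq: "\<psi> t - \<psi> 0
        = t * (frechet_derivative f (at (p + (t *\<^sub>R u + s *\<^sub>R v))) v
            - frechet_derivative f (at (p + s *\<^sub>R v)) v)"
      by auto
    define A where "A = frechet_derivative f (at (p + (t *\<^sub>R u + s *\<^sub>R v))) v
        - frechet_derivative f (at p) v - second_deriv f p (t *\<^sub>R u + s *\<^sub>R v) v"
    define A' where "A' = frechet_derivative f (at (p + s *\<^sub>R v)) v
        - frechet_derivative f (at p) v - second_deriv f p (s *\<^sub>R v) v"
    have "\<bar>A\<bar> \<le> e' * norm (t *\<^sub>R u + s *\<^sub>R v) * norm v"
      unfolding A_def using b[OF nb(4)[of s]] s by simp
    also have "\<dots> \<le> e' * (t * (norm u + norm v)) * norm v"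
      using nb(2)[of s] s e' by (intro mult_mono) auto
    finally have A: "\<bar>A\<bar> \<le> e' * (t * (norm u + norm v)) * norm v" .
    have "\<bar>A'\<bar> \<le> e' * norm (s *\<^sub>R v) * norm v"
      unfolding A'_def using b[OF nb(3)[of s]] s by simp
    also have "\<dots> \<le> e' * (t * norm v) * norm v"
      using nb(1)[of s] s e' by (intro mult_mono) auto
    finally have A': "\<bar>A'\<bar> \<le> e' * (t * norm v) * norm v" .
    have "\<psi> t - \<psi> 0 - t\<^sup>2 * second_deriv f p u v = t * (A - A')"
      unfolding eq A_def A'_def by (simp add: B.add_left B.scaleR_left algebra_simps power2_eq_square)
    also have "\<bar>\<dots>\<bar> \<le> t * (\<bar>A\<bar> + \<bar>A'\<bar>)"
      using t by (simp add: abs_mult)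
    also have "\<dots> \<le> t * (e' * (t * (norm u + norm v)) * norm v + e' * (t * norm v) * norm v)"
      using A A' t by (intro mult_left_mono) auto
    also have "\<dots> = e' * (M - 1) * t\<^sup>2"
      by (simp add: M_def algebra_simps power2_eq_square)
    also have "\<dots> \<le> e' * M * t\<^sup>2" using e' by (intro mult_right_mono mult_left_mono) auto
    also have "\<dots> = e * t\<^sup>2" using M by (simp add: e'_def)
    finally show ?thesis by (simp add: \<psi>_def algebra_simps)
  qed
  ultimately show ?thesis using that by blast
qed

text \<open>Both values are limits of the same second difference divided by
  \<open>t\<^sup>2\<close>.\<close>

lemma second_deriv_sym:
  assumes "smooth_on U f" and "open U" and "p \<in> U"
  shows "second_deriv f p u v = second_deriv f p v u"
proof -
  have "\<bar>second_deriv f p u v - second_deriv f p v u\<bar> \<le> 0 + e" if "e > 0" for e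
  proof -
    have e2: "e / 2 > 0" using that by simp
    obtain d1 where d1: "d1 > 0" "\<And>t. 0 < t \<Longrightarrow> t < d1 \<Longrightarrow>
      \<bar>f (p + t *\<^sub>R (u + v)) - f (p + t *\<^sub>R u) - f (p + t *\<^sub>R v) + f p - t\<^sup>2 * second_deriv f p u v\<bar>
        \<le> e / 2 * t\<^sup>2" using second_difference_bound[OF assms e2] by blast
    obtain d2 where d2: "d2 > 0" "\<And>t. 0 < t \<Longrightarrow> t < d2 \<Longrightarrow>
      \<bar>f (p + t *\<^sub>R (v + u)) - f (p + t *\<^sub>R v) - f (p + t *\<^sub>R u) + f p - t\<^sup>2 * second_deriv f p v u\<bar>
        \<le> e / 2 * t\<^sup>2" using second_difference_bound[OF assms e2] by blast
    define t where "t = min d1 d2 / 2"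
    have t: "0 < t" "t < d1" "t < d2" using d1(1) d2(1) by (auto simp: t_def)
    have "\<bar>t\<^sup>2 * second_deriv f p u v - t\<^sup>2 * second_deriv f p v u\<bar> \<le> e / 2 * t\<^sup>2 + e / 2 * t\<^sup>2"
      using d1(2)[OF t(1,2)] d2(2)[OF t(1,3)] unfolding add.commute[of v u] by linarith
    moreover have "\<bar>t\<^sup>2 * second_deriv f p u v - t\<^sup>2 * second_deriv f p v u\<bar>
        = t\<^sup>2 * \<bar>second_deriv f p u v - second_deriv f p v u\<bar>"
      by (simp add: abs_mult flip: right_diff_distrib)
    ultimately have "t\<^sup>2 * \<bar>second_deriv f p u v - second_deriv f p v u\<bar> \<le> t\<^sup>2 * e"
      by (simp add: mult_ac)
    then show ?thesis using t(1) by simp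
  qed
  then show ?thesis using field_le_epsilon[of "\<bar>second_deriv f p u v - second_deriv f p v u\<bar>" 0] by simp
qed

section \<open>Tangent vectors of hypersurfaces\<close>

text \<open>The Bouligand contingent cone. It gives tangent vectors of the boundary without
  parametrizing it, and its sequences are exactly what derivatives within \<open>S\<close> can be
  tested on.\<close>

definition tangent_cone :: "'a::real_normed_vector set \<Rightarrow> 'a \<Rightarrow> 'a set" where
  "tangent_cone S p = {v. \<exists>(t :: nat \<Rightarrow> real) y. (\<forall>m. t m > 0) \<and> t \<longlonglongrightarrow> 0 \<and> y \<longlonglongrightarrow> v \<and>
     (\<forall>m. p + t m *\<^sub>R y m \<in> S)}"

lemma tendsto_difference_quotient:
  fixes t :: "nat \<Rightarrow> real"
  assumes "(f has_derivative D) (at p within S)"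
    and t: "\<And>m. t m > 0" "t \<longlonglongrightarrow> 0" and y: "y \<longlonglongrightarrow> v" "\<And>m. p + t m *\<^sub>R y m \<in> S"
  shows "(\<lambda>m. (f (p + t m *\<^sub>R y m) - f p) /\<^sub>R t m) \<longlonglongrightarrow> D v"
proof -
  have lin: "bounded_linear D" using assms(1) by (rule has_derivative_bounded_linear)
  have "(\<lambda>m. (f (p + t m *\<^sub>R y m) - f p) /\<^sub>R t m - D (y m)) \<longlonglongrightarrow> 0"
  proof (rule tendstoI)
    fix e :: real assume "e > 0"
    define e' where "e' = e / (norm v + 1)"
    have e': "e' > 0" using \<open>e > 0\<close> by (simp add: e'_def add_nonneg_pos)
    obtain d where "d > 0" and d: "\<And>x. x \<in> S \<Longrightarrow> norm (x - p) < d \<Longrightarrow>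
        norm (f x - f p - D (x - p)) \<le> e' * norm (x - p)"
      using assms(1) e' unfolding has_derivative_within_alt by blast
    have "(\<lambda>m. t m *\<^sub>R y m) \<longlonglongrightarrow> 0 *\<^sub>R v" by (intro tendsto_intros t y)
    then have "\<forall>\<^sub>F m in sequentially. dist (t m *\<^sub>R y m) 0 < d"
      using \<open>d > 0\<close> by (auto dest: tendstoD)
    moreover have "\<forall>\<^sub>F m in sequentially. norm (y m) < norm v + 1"
      by (rule order_tendstoD(2)[OF tendsto_norm[OF y(1)]]) simp
    ultimately show "\<forall>\<^sub>F m in sequentially.
        dist ((f (p + t m *\<^sub>R y m) - f p) /\<^sub>R t m - D (y m)) 0 < e"
    proof eventually_elim
      case (elim m)
      have "(f (p + t m *\<^sub>R y m) - f p) /\<^sub>R t m - D (y m)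
          = (f (p + t m *\<^sub>R y m) - f p - D (t m *\<^sub>R y m)) /\<^sub>R t m"
        using t(1)[of m] linear_scale[OF bounded_linear.linear[OF lin]]
        by (simp add: algebra_simps)
      then have "norm ((f (p + t m *\<^sub>R y m) - f p) /\<^sub>R t m - D (y m))
          = norm (f (p + t m *\<^sub>R y m) - f p - D (t m *\<^sub>R y m)) / t m"
        using t(1)[of m] by (simp only: norm_scaleR) (simp add: divide_inverse mult.commute)
      also have "\<dots> \<le> e' * norm (t m *\<^sub>R y m) / t m"
        using d[OF y(2)[of m]] elim(1) t(1)[of m] by (intro divide_right_mono) auto
      also have "\<dots> = e' * norm (y m)" using t(1)[of m] by simp
      also have "\<dots> < e' * (norm v + 1)" using elim(2) e' by simp
      also have "\<dots> = e" by (simp add: e'_def add_nonneg_eq_0_iff)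
      finally show ?case by simp
    qed
  qed
  from tendsto_add[OF this bounded_linear.tendsto[OF lin y(1)]] show ?thesis by simp
qed

text \<open>Both values are the limit of the same difference quotients along points of
  \<open>S\<close>. This is why an arbitrary choice of derivative within \<open>S\<close> does no
  harm for tangential fields.\<close>

lemma tangent_cone_derivative_unique:
  assumes "(f has_derivative D) (at p within S)" and "(f has_derivative D') (at p within S)"
    and "v \<in> tangent_cone S p"
  shows "D v = D' v"
  using assms(3) tendsto_difference_quotient[OF assms(1)] tendsto_difference_quotient[OF assms(2)]
  unfolding tangent_cone_def by (blast intro: LIMSEQ_unique)

lemma tangent_cone_derivative_nonneg:
  fixes f :: "'a::real_normed_vector \<Rightarrow> real"
  assumes "(f has_derivative D) (at p)" and "open W" and "p \<in> W"
    and ge: "\<And>x. x \<in> S \<inter> W \<Longrightarrow> f p \<le> f x" and "v \<in> tangent_cone S p"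
  shows "0 \<le> D v"
proof -
  obtain t y where t: "\<And>m. t m > 0" "t \<longlonglongrightarrow> 0" and y: "y \<longlonglongrightarrow> v"
    "\<And>m. p + t m *\<^sub>R y m \<in> S" using assms(5) unfolding tangent_cone_def by blast
  have "(\<lambda>m. p + t m *\<^sub>R y m) \<longlonglongrightarrow> p + 0 *\<^sub>R v" by (intro tendsto_intros t y)
  then have "\<forall>\<^sub>F m in sequentially. p + t m *\<^sub>R y m \<in> W"
    using assms(2,3) by (simp add: topological_tendstoD)
  then have "\<forall>\<^sub>F m in sequentially. 0 \<le> (f (p + t m *\<^sub>R y m) - f p) /\<^sub>R t m"
  proof eventually_elim
    case (elim m)
    then have "f p \<le> f (p + t m *\<^sub>R y m)" using ge y(2) by blast
    then show ?case using t(1)[of m] by simp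
  qed
  with tendsto_lowerbound[OF tendsto_difference_quotient[OF
      has_derivative_at_withinI[OF assms(1)] t y]] show ?thesis by simp
qed

lemma tangent_cone_derivative_zero:
  fixes f :: "'a::real_normed_vector \<Rightarrow> real"
  assumes "(f has_derivative D) (at p)" and "open W" and "p \<in> W"
    and "f p = 0" and "\<And>x. x \<in> S \<inter> W \<Longrightarrow> f x = 0" and "v \<in> tangent_cone S p"
  shows "D v = 0"
proof -
  have "0 \<le> D v"
    using tangent_cone_derivative_nonneg[OF assms(1-3) _ assms(6)] assms(4,5) by simp
  moreover have "0 \<le> - D v"
    using tangent_cone_derivative_nonneg[OF has_derivative_minus[OF assms(1)] assms(2,3) _ assms(6)]
      assms(4,5) by simp
  ultimately show ?thesis by simp
qed

text \<open>In the Taylor expansion along points \<open>p + t m *\<^sub>R y m\<close> of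
  \<open>S\<close> only the quadratic term is left, and it has to be of smaller order than
  \<open>(t m)\<^sup>2\<close>. With a nonzero differential, the deviation of \<open>y m\<close>
  from \<open>v\<close> could contribute at that order.\<close>

lemma tangent_cone_second_deriv_zero:
  assumes "smooth_on W f" and "open W" and "p \<in> W"
    and f0: "f p = 0" "\<And>x. x \<in> S \<inter> W \<Longrightarrow> f x = 0" and D0: "\<And>u. frechet_derivative f (at p) u = 0"
    and "v \<in> tangent_cone S p"
  shows "second_deriv f p v v = 0"
proof -
  interpret B: bounded_bilinear "second_deriv f p"
    by (rule bounded_bilinear_second_deriv[OF assms(1-3)])
  obtain t y where t: "\<And>m. t m > 0" "t \<longlonglongrightarrow> 0" and y: "y \<longlonglongrightarrow> v"
    "\<And>m. p + t m *\<^sub>R y m \<in> S" using assms(7) unfolding tangent_cone_def by blast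
  have lim0: "(\<lambda>m. t m *\<^sub>R y m) \<longlonglongrightarrow> 0"
    using tendsto_scaleR[OF t(2) y(1)] by simp
  have lim: "(\<lambda>m. p + t m *\<^sub>R y m) \<longlonglongrightarrow> p"
    using tendsto_add[OF tendsto_const[of p] lim0] by simp
  have small: "\<bar>second_deriv f p v v\<bar> / 2 \<le> e * (norm v)\<^sup>2" if e: "e > 0" for e
  proof -
    obtain d where "d > 0" and d: "\<And>h. norm h < d \<Longrightarrow> \<bar>f (p + h) - f p
      - frechet_derivative f (at p) h - second_deriv f p h h / 2\<bar> \<le> e * (norm h)\<^sup>2"
      using second_order_Taylor[OF assms(1-3) e] by blast
    have "\<forall>\<^sub>F m in sequentially. p + t m *\<^sub>R y m \<in> W"
      using lim assms(2,3) by (simp add: topological_tendstoD)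
    moreover have "\<forall>\<^sub>F m in sequentially. norm (t m *\<^sub>R y m) < d"
      using tendstoD[OF lim0 \<open>d > 0\<close>] by simp
    ultimately have "\<forall>\<^sub>F m in sequentially. \<bar>second_deriv f p (y m) (y m)\<bar> / 2 \<le> e * (norm (y m))\<^sup>2"
    proof eventually_elim
      case (elim m)
      have "(t m)\<^sup>2 * (\<bar>second_deriv f p (y m) (y m)\<bar> / 2) \<le> (t m)\<^sup>2 * (e * (norm (y m))\<^sup>2)"
        using d[OF elim(2)] f0 elim(1) y(2)[of m] D0 t(1)[of m]
        by (simp add: B.scaleR_left B.scaleR_right power_mult_distrib abs_mult power2_eq_square mult_ac)
      then show ?case using t(1)[of m] by (simp only: mult_le_cancel_left) (smt (verit) zero_less_power)
    qed
    then show ?thesis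
      by (rule tendsto_le[OF sequentially_bot, rotated 2]) (intro tendsto_intros B.tendsto y; simp)+
  qed
  have "\<bar>second_deriv f p v v\<bar> / 2 \<le> 0 + e" if "e > 0" for e
  proof -
    \<comment> \<open>The added 1 covers \<open>v = 0\<close>.\<close>
    have "e / ((norm v)\<^sup>2 + 1) > 0" using that by (simp add: add_nonneg_pos)
    from small[OF this]
    have "\<bar>second_deriv f p v v\<bar> / 2 \<le> e / ((norm v)\<^sup>2 + 1) * (norm v)\<^sup>2" .
    also have "\<dots> \<le> e" using that by (simp add: pos_divide_le_eq add_nonneg_pos distrib_left)
    finally show ?thesis by simp
  qed
  then have "\<bar>second_deriv f p v v\<bar> / 2 \<le> 0" using field_le_epsilon by blast
  then show ?thesis by simp
qed

lemma ray_in_open: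
  fixes p x :: "'a::real_normed_vector"
  assumes "open U" and "p \<in> U"
  obtains d where "d > 0" and "\<And>h. 0 < h \<Longrightarrow> h < d \<Longrightarrow> p + h *\<^sub>R x \<in> U"
proof -
  have "((\<lambda>h. p + h *\<^sub>R x) \<longlongrightarrow> p + 0 *\<^sub>R x) (at 0)" by (intro tendsto_intros)
  then have "\<forall>\<^sub>F h in at 0. p + h *\<^sub>R x \<in> U"
    using assms by (simp add: topological_tendstoD)
  then obtain d where "d > 0" and d: "\<forall>h\<in>UNIV. h \<noteq> 0 \<and> dist h 0 < d \<longrightarrow> p + h *\<^sub>R x \<in> U"
    unfolding eventually_at by blast
  show ?thesis by (rule that[OF \<open>d > 0\<close>]) (use d in simp)
qed

text \<open>A connectedness argument takes the place of the implicit function theorem: slightly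
  tilted copies of \<open>v\<close> lead to opposite sides of \<Omega>, so the segment between their
  endpoints meets the frontier.\<close>

lemma mem_tangent_cone_frontier:
  fixes r :: "'a::real_normed_vector \<Rightarrow> real"
  assumes r: "(r has_derivative D) (at p)" and "open U" and "p \<in> U" and "r p = 0"
    and \<Omega>: "\<Omega> \<inter> U = {q \<in> U. r q < 0}" and "D n > 0" and "D v = 0"
  shows "v \<in> tangent_cone (frontier \<Omega>) p"
proof -
  have lin: "linear D" using r by (rule has_derivative_linear)
  have "\<exists>t y. 0 < t \<and> t < \<delta> \<and> norm (y - v) \<le> \<delta> * norm n \<and> p + t *\<^sub>R y \<in> frontier \<Omega>"
    if "\<delta> > 0" for \<delta> :: real
  proof -
    have der: "((\<lambda>s. r (p + s *\<^sub>R w)) has_real_derivative D w) (at 0)" for w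
      using DERIV_along_line[of r D p 0 w] r by simp
    \<comment> \<open>Since \<open>D v = 0\<close>, the tilt by \<open>n\<close> alone decides the
      sign of \<open>r\<close> to first order.\<close>
    define w w' where "w = v + \<delta> *\<^sub>R n" and "w' = v - \<delta> *\<^sub>R n"
    have "D w > 0" "D w' < 0"
      using that assms(6,7)
      by (simp_all add: w_def w'_def linear_add[OF lin] linear_diff[OF lin] linear_scale[OF lin])
    obtain d1 where d1: "d1 > 0" "\<And>h. 0 < h \<Longrightarrow> h < d1 \<Longrightarrow> r (p + h *\<^sub>R w) > 0"
      using DERIV_pos_inc_right[OF der \<open>D w > 0\<close>] assms(4) by auto
    obtain d2 where d2: "d2 > 0" "\<And>h. 0 < h \<Longrightarrow> h < d2 \<Longrightarrow> r (p + h *\<^sub>R w') < 0"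
      using DERIV_neg_dec_right[OF der \<open>D w' < 0\<close>] assms(4) by auto
    obtain d3 where d3: "d3 > 0" "\<And>h. 0 < h \<Longrightarrow> h < d3 \<Longrightarrow> p + h *\<^sub>R w \<in> U"
      using ray_in_open[OF assms(2,3)] by blast
    obtain d4 where d4: "d4 > 0" "\<And>h. 0 < h \<Longrightarrow> h < d4 \<Longrightarrow> p + h *\<^sub>R w' \<in> U"
      using ray_in_open[OF assms(2,3)] by blast
    define t where "t = Min {\<delta>, d1, d2, d3, d4} / 2"
    have t: "0 < t" "t < \<delta>" "t < d1" "t < d2" "t < d3" "t < d4"
      using that d1(1) d2(1) d3(1) d4(1) by (auto simp: t_def min_def)
    have mem: "x \<in> \<Omega> \<longleftrightarrow> r x < 0" if "x \<in> U" for x using \<Omega> that by blast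
    have "p + t *\<^sub>R w' \<in> \<Omega>" using d2(2) d4(2) t mem by blast
    moreover have "p + t *\<^sub>R w \<notin> \<Omega>" using d1(2)[OF t(1,3)] d3(2)[OF t(1,5)] mem by simp
    ultimately obtain x where "x \<in> closed_segment (p + t *\<^sub>R w') (p + t *\<^sub>R w)" "x \<in> frontier \<Omega>"
      using connected_Int_frontier[OF connected_segment(1), of "p + t *\<^sub>R w'" "p + t *\<^sub>R w" \<Omega>]
      by auto
    then obtain u where u: "0 \<le> u" "u \<le> 1"
      "(1 - u) *\<^sub>R (p + t *\<^sub>R w') + u *\<^sub>R (p + t *\<^sub>R w) \<in> frontier \<Omega>"
      unfolding closed_segment_def by auto
    \<comment> \<open>The frontier point at parameter \<open>u\<close> of the segment, rescaled:
      \<open>u = 0\<close> gives \<open>w'\<close> and \<open>u = 1\<close> gives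
      \<open>w\<close>.\<close>
    define y where "y = v + ((2 * u - 1) * \<delta>) *\<^sub>R n"
    have "(1 - u) *\<^sub>R (p + t *\<^sub>R w') + u *\<^sub>R (p + t *\<^sub>R w) = p + t *\<^sub>R y"
      by (simp add: w_def w'_def y_def algebra_simps flip: scaleR_add_left)
    moreover have "norm (y - v) \<le> \<delta> * norm n"
      using u(1,2) that mult_left_le_one_le[of "norm n" "\<bar>2 * u - 1\<bar>"]
      by (simp add: y_def abs_mult)
    ultimately show ?thesis using t u(3) by metis
  qed
  then have "\<exists>t y. 0 < t \<and> t < inverse (real (Suc m)) \<and> norm (y - v) \<le> inverse (real (Suc m)) * norm n
      \<and> p + t *\<^sub>R y \<in> frontier \<Omega>" for m
    by simp
  then obtain t y where ty: "\<And>m. 0 < t m" "\<And>m. t m < inverse (real (Suc m))"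
    "\<And>m. norm (y m - v) \<le> inverse (real (Suc m)) * norm n" "\<And>m. p + t m *\<^sub>R y m \<in> frontier \<Omega>"
    by metis
  have "t \<longlonglongrightarrow> 0"
    by (rule tendsto_sandwich[OF _ _ tendsto_const LIMSEQ_inverse_real_of_nat])
      (use ty(1,2) in \<open>auto intro!: always_eventually less_imp_le\<close>)
  moreover have "(\<lambda>m. y m - v) \<longlonglongrightarrow> 0"
  proof (rule Lim_null_comparison)
    show "(\<lambda>m. inverse (real (Suc m)) * norm n) \<longlonglongrightarrow> 0"
      using tendsto_mult_left_zero[OF LIMSEQ_inverse_real_of_nat] by blast
  qed (use ty(3) in auto)
  then have "y \<longlonglongrightarrow> v" by (simp add: LIM_zero_iff)
  ultimately show ?thesis using ty(1,4) unfolding tangent_cone_def by blast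
qed

section \<open>Defining functions\<close>

text \<open>A boundary point of an open set lies outside it, so \<open>r\<close> is nonnegative
  there; a positive value would persist nearby and separate the point from \<Omega>.\<close>

lemma local_defining_zero:
  assumes "open \<Omega>" and "local_defining \<Omega> p U r" and "q \<in> frontier \<Omega> \<inter> U"
  shows "r q = 0"
proof (rule ccontr)
  note ld = assms(2)[unfolded local_defining_def]
  assume "r q \<noteq> 0"
  have "q \<notin> \<Omega>" using assms(1,3) by (simp add: frontier_def interior_open)
  moreover have mem: "x \<in> \<Omega> \<longleftrightarrow> r x < 0" if "x \<in> U" for x using ld that by blast
  ultimately have "r q > 0" using mem[of q] assms(3) \<open>r q \<noteq> 0\<close> by auto
  have "continuous_on U r" using ld smooth_on_imp_continuous_on by blast
  then have "open (U \<inter> r -` {0<..})" using ld by (auto intro!: continuous_open_preimage)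
  moreover have "q \<in> U \<inter> r -` {0<..}" using \<open>r q > 0\<close> assms(3) by simp
  moreover have "q \<in> closure \<Omega>" using assms(3) by (simp add: frontier_def)
  ultimately obtain x where "x \<in> \<Omega>" "x \<in> U" "r x > 0"
    using open_Int_closure_eq_empty[of "U \<inter> r -` {0<..}" \<Omega>] by auto
  then show False using mem[of x] by simp
qed

lemma local_defining_tangent_cone:
  assumes "open \<Omega>" and "local_defining \<Omega> p U r" and "q \<in> frontier \<Omega> \<inter> U"
    and "frechet_derivative r (at q) v = 0"
  shows "v \<in> tangent_cone (frontier \<Omega>) q"
proof -
  note ld = assms(2)[unfolded local_defining_def]
  have der: "(r has_derivative frechet_derivative r (at q)) (at q)"
    using ld assms(3) smooth_on_has_derivative by blast
  obtain n where "frechet_derivative r (at q) n \<noteq> 0" using ld assms(3) by blast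
  then obtain n where "frechet_derivative r (at q) n > 0"
    using linear_neg[OF has_derivative_linear[OF der]]
    by (metis linorder_neqE_linordered_idom neg_0_less_iff_less)
  with mem_tangent_cone_frontier[OF der] show ?thesis
    using ld assms local_defining_zero[OF assms(1-3)] by blast
qed

lemma frechet_derivative_diff_scale:
  fixes f g :: "'a::euclidean_space \<Rightarrow> real"
  assumes "smooth_on W f" and "smooth_on W g" and "x \<in> W"
  shows "frechet_derivative (\<lambda>x. f x + (- c) * g x) (at x) v
    = frechet_derivative f (at x) v - c * frechet_derivative g (at x) v"
proof -
  have "((\<lambda>x. f x + (- c) * g x) has_derivative (\<lambda>v. frechet_derivative f (at x) v
      + (- c) * frechet_derivative g (at x) v)) (at x)"
    by (intro has_derivative_add[OF smooth_on_has_derivative[OF assms(1,3)]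
          bounded_linear.has_derivative[OF bounded_linear_mult_right smooth_on_has_derivative[OF assms(2,3)]]])
  from fun_cong[OF frechet_derivative_at[OF this], of v] show ?thesis by simp
qed

lemma second_deriv_diff_scale:
  fixes f g :: "'a::euclidean_space \<Rightarrow> real"
  assumes "smooth_on W f" and "smooth_on W g" and "open W" and "x \<in> W"
  shows "second_deriv (\<lambda>x. f x + (- c) * g x) x u v
    = second_deriv f x u v - c * second_deriv g x u v"
proof -
  have "((\<lambda>x. frechet_derivative f (at x) v - c * frechet_derivative g (at x) v) has_derivative
      (\<lambda>u. second_deriv f x u v - c * second_deriv g x u v)) (at x)"
    using has_second_deriv[OF assms(1,4)] has_second_deriv[OF assms(2,4)]
    by (intro has_derivative_diff has_derivative_mult_right)
  then have "((\<lambda>x. frechet_derivative (\<lambda>x. f x + (- c) * g x) (at x) v) has_derivative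
      (\<lambda>u. second_deriv f x u v - c * second_deriv g x u v)) (at x)"
    by (rule has_derivative_transform_within_open[OF _ assms(3,4)])
      (simp only: frechet_derivative_diff_scale[OF assms(1,2)])
  from fun_cong[OF frechet_derivative_at[OF this], of u] show ?thesis
    by (simp add: second_deriv_def)
qed

text \<open>A pointwise substitute for writing \<open>r'\<close> as a positive smooth multiple of
  \<open>r\<close>. Tangent vectors, that is the kernel of the differential of \<open>r\<close>, are
  killed by that of \<open>r'\<close>, so the differentials are proportional; the second derivatives
  are compared through a combination that vanishes on the boundary.\<close>

lemma local_defining_proportional:
  assumes "open \<Omega>" and ld1: "local_defining \<Omega> p U r" and ld2: "local_defining \<Omega> p' U' r'"
    and q: "q \<in> frontier \<Omega>" "q \<in> U" "q \<in> U'"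
  obtains c where "c > 0"
    and "\<And>v. frechet_derivative r' (at q) v = c * frechet_derivative r (at q) v"
    and "\<And>v. frechet_derivative r (at q) v = 0 \<Longrightarrow> second_deriv r' q v v = c * second_deriv r q v v"
proof -
  note ld = ld1[unfolded local_defining_def] ld2[unfolded local_defining_def]
  define D where "D = frechet_derivative r (at q)"
  define D' where "D' = frechet_derivative r' (at q)"
  have der: "(r has_derivative D) (at q)" "(r' has_derivative D') (at q)"
    unfolding D_def D'_def using ld q smooth_on_has_derivative by blast+
  have lin: "linear D" "linear D'" using der has_derivative_linear by auto
  have zero: "r x = 0" if "x \<in> frontier \<Omega> \<inter> U" for x
    using local_defining_zero[OF assms(1) ld1 that] .
  have zero': "r' x = 0" if "x \<in> frontier \<Omega> \<inter> U'" for x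
    using local_defining_zero[OF assms(1) ld2 that] .
  have ker: "D' v = 0" if "D v = 0" for v
  proof (rule tangent_cone_derivative_zero[OF der(2), where W = U' and S = "frontier \<Omega>"])
    show "v \<in> tangent_cone (frontier \<Omega>) q"
      using local_defining_tangent_cone[OF assms(1) ld1, of q v] that q by (simp add: D_def)
  qed (use ld q zero' in auto)
  obtain n0 where n0: "D n0 \<noteq> 0" using ld q unfolding D_def by blast
  then obtain n where n: "D n < 0"
    using linear_neg[OF lin(1)] by (metis linorder_neqE_linordered_idom neg_less_0_iff_less)
  define c where "c = D' n / D n"
  have propor: "D' v = c * D v" for v
  proof -
    have "D (v - (D v / D n) *\<^sub>R n) = 0"
      using n by (simp add: linear_diff[OF lin(1)] linear_scale[OF lin(1)])
    from ker[OF this] show ?thesis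
      by (simp add: c_def linear_diff[OF lin(2)] linear_scale[OF lin(2)])
  qed
  have "D' \<noteq> (\<lambda>v. 0)" using ld q unfolding D'_def by blast
  then have "c \<noteq> 0" using propor by auto
  \<comment> \<open>Moving from \<open>q\<close> along \<open>n\<close> makes \<open>r\<close>
    negative and so enters \<Omega>, where \<open>r'\<close> must be negative too.\<close>
  have "D' n \<le> 0"
  proof (rule ccontr)
    assume "\<not> D' n \<le> 0"
    then have "D' n > 0" by simp
    have der': "((\<lambda>s. r (q + s *\<^sub>R n)) has_real_derivative D n) (at 0)"
      "((\<lambda>s. r' (q + s *\<^sub>R n)) has_real_derivative D' n) (at 0)"
      using DERIV_along_line[of r D q 0 n] DERIV_along_line[of r' D' q 0 n] der by simp_all
    obtain d1 where d1: "d1 > 0" "\<And>h. 0 < h \<Longrightarrow> h < d1 \<Longrightarrow> r' (q + h *\<^sub>R n) > 0"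
      using DERIV_pos_inc_right[OF der'(2) \<open>D' n > 0\<close>] zero' q by auto
    obtain d2 where d2: "d2 > 0" "\<And>h. 0 < h \<Longrightarrow> h < d2 \<Longrightarrow> r (q + h *\<^sub>R n) < 0"
      using DERIV_neg_dec_right[OF der'(1) n] zero q by auto
    obtain d3 where d3: "d3 > 0" "\<And>h. 0 < h \<Longrightarrow> h < d3 \<Longrightarrow> q + h *\<^sub>R n \<in> U \<inter> U'"
      using ray_in_open[of "U \<inter> U'" q n] ld q by blast
    define t where "t = Min {d1, d2, d3} / 2"
    have t: "0 < t" "t < d1" "t < d2" "t < d3"
      using d1(1) d2(1) d3(1) by (auto simp: t_def min_def)
    have "q + t *\<^sub>R n \<in> \<Omega>" using d2(2) d3(2) t ld by blast
    then have "r' (q + t *\<^sub>R n) < 0" using d3(2) t ld by blast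
    with d1(2)[OF t(1,2)] show False by simp
  qed
  then have "c > 0" using \<open>c \<noteq> 0\<close> n divide_nonpos_neg[of "D' n" "D n"] by (simp add: c_def less_le)
  moreover have "second_deriv r' q v v = c * second_deriv r q v v" if "D v = 0" for v
  proof -
    \<comment> \<open>By the choice of \<open>c\<close> the differential at \<open>q\<close>
      vanishes, and the function itself vanishes on the boundary near \<open>q\<close>.\<close>
    define \<phi> where "\<phi> x = r' x + (- c) * r x" for x
    have W: "open (U \<inter> U')" "q \<in> U \<inter> U'" "smooth_on (U \<inter> U') r" "smooth_on (U \<inter> U') r'"
      using ld q smooth_on_subset by (auto intro: smooth_on_subset)
    have "second_deriv \<phi> q v v = 0"
    proof (rule tangent_cone_second_deriv_zero)
      show "smooth_on (U \<inter> U') \<phi>"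
        unfolding \<phi>_def using W
        by (intro smooth_on_add smooth_on_bounded_linear[where T = "\<lambda>x. (- c) * x"]
            bounded_linear_mult_right)
      show "v \<in> tangent_cone (frontier \<Omega>) q"
        using local_defining_tangent_cone[OF assms(1) ld1, of q v] that q by (simp add: D_def)
      show "frechet_derivative \<phi> (at q) u = 0" for u
        using frechet_derivative_diff_scale[OF W(4,3,2), of c u] propor[of u]
        unfolding \<phi>_def D_def D'_def by simp
    qed (use W zero zero' q in \<open>auto simp: \<phi>_def\<close>)
    with second_deriv_diff_scale[OF W(4,3,1,2)] show ?thesis unfolding \<phi>_def by simp
  qed
  ultimately show ?thesis using that propor unfolding D_def D'_def by blast
qed

section \<open>The Levi form\<close>

definition mult_i :: "C2 \<Rightarrow> C2" where
  "mult_i v = (\<i> * fst v, \<i> * snd v)"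

lemma C2_decompose:
  "v = Re (fst v) *\<^sub>R (1, 0) + Im (fst v) *\<^sub>R (\<i>, 0) + Re (snd v) *\<^sub>R (0, 1) + Im (snd v) *\<^sub>R (0, \<i>)"
  for v :: C2
  by (auto simp: prod_eq_iff complex_eq_iff)

lemma mult_i_decompose:
  "mult_i v = (- Im (fst v)) *\<^sub>R (1, 0) + Re (fst v) *\<^sub>R (\<i>, 0)
     + (- Im (snd v)) *\<^sub>R (0, 1) + Re (snd v) *\<^sub>R (0, \<i>)"
  by (auto simp: mult_i_def prod_eq_iff complex_eq_iff)

text \<open>Both sides are the complex linear part of \<open>D\<close> at \<open>l\<close>;
  \<open>coef_bar_sum\<close> is the same for the antilinear part. Everything below can thus be
  phrased with real derivatives along \<open>l\<close> and \<open>mult_i l\<close>.\<close>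

lemma coef_sum:
  fixes D :: "C2 \<Rightarrow> complex"
  assumes "linear D"
  shows "fst l * coef_z D + snd l * coef_w D = (D l - \<i> * D (mult_i l)) / 2"
proof -
  have "D l = Re (fst l) * D (1, 0) + Im (fst l) * D (\<i>, 0) + Re (snd l) * D (0, 1) + Im (snd l) * D (0, \<i>)"
    by (subst C2_decompose[of l])
      (simp only: linear_add[OF assms] linear_scale[OF assms] scaleR_conv_of_real)
  moreover have "D (mult_i l) = - Im (fst l) * D (1, 0) + Re (fst l) * D (\<i>, 0)
      + - Im (snd l) * D (0, 1) + Re (snd l) * D (0, \<i>)"
    by (subst mult_i_decompose[of l])
      (simp only: linear_add[OF assms] linear_scale[OF assms] scaleR_conv_of_real)
  ultimately show ?thesis
    by (simp only: coef_z_def coef_w_def) (simp add: complex_eq_iff field_simps)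
qed

lemma coef_bar_sum:
  fixes D :: "C2 \<Rightarrow> complex"
  assumes "linear D"
  shows "cnj (fst l) * coef_zbar D + cnj (snd l) * coef_wbar D = (D l + \<i> * D (mult_i l)) / 2"
proof -
  have "D l = Re (fst l) * D (1, 0) + Im (fst l) * D (\<i>, 0) + Re (snd l) * D (0, 1) + Im (snd l) * D (0, \<i>)"
    by (subst C2_decompose[of l])
      (simp only: linear_add[OF assms] linear_scale[OF assms] scaleR_conv_of_real)
  moreover have "D (mult_i l) = - Im (fst l) * D (1, 0) + Re (fst l) * D (\<i>, 0)
      + - Im (snd l) * D (0, 1) + Re (snd l) * D (0, \<i>)"
    by (subst mult_i_decompose[of l])
      (simp only: linear_add[OF assms] linear_scale[OF assms] scaleR_conv_of_real)
  ultimately show ?thesis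
    by (simp only: coef_zbar_def coef_wbar_def) (simp add: complex_eq_iff field_simps)
qed

lemma frechet_derivative_cplx:
  assumes "smooth_on U r" and "x \<in> U"
  shows "frechet_derivative (cplx r) (at x) = (\<lambda>v. complex_of_real (frechet_derivative r (at x) v))"
  by (rule frechet_derivative_at[symmetric])
    (rule bounded_linear.has_derivative[OF bounded_linear_of_real smooth_on_has_derivative[OF assms]])

text \<open>With \<open>k\<close> equal to \<open>\<i>\<close> or \<open>- \<i>\<close> this covers
  all the Wirtinger derivatives at once.\<close>

lemma frechet_derivative_deriv_cplx:
  assumes "smooth_on U r" and "open U" and "p \<in> U"
  shows "frechet_derivative (\<lambda>x. (frechet_derivative (cplx r) (at x) a
        + k * frechet_derivative (cplx r) (at x) b) / 2) (at p)
      = (\<lambda>u. (of_real (second_deriv r p u a) + k * of_real (second_deriv r p u b)) / 2)"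
proof -
  have *: "((\<lambda>x. complex_of_real (frechet_derivative r (at x) v)) has_derivative
      (\<lambda>u. of_real (second_deriv r p u v))) (at p)" for v
    by (rule bounded_linear.has_derivative[OF bounded_linear_of_real has_second_deriv[OF assms(1,3)]])
  have "((\<lambda>x. (of_real (frechet_derivative r (at x) a)
        + k * of_real (frechet_derivative r (at x) b)) / 2) has_derivative
      (\<lambda>u. (of_real (second_deriv r p u a) + k * of_real (second_deriv r p u b)) / 2)) (at p)"
    by (intro bounded_linear.has_derivative[OF bounded_linear_divide] has_derivative_add
        has_derivative_mult_right *)
  then have "((\<lambda>x. (frechet_derivative (cplx r) (at x) a
        + k * frechet_derivative (cplx r) (at x) b) / 2) has_derivative
      (\<lambda>u. (of_real (second_deriv r p u a) + k * of_real (second_deriv r p u b)) / 2)) (at p)"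
    by (rule has_derivative_transform_within_open[OF _ assms(2,3)])
      (simp only: frechet_derivative_cplx[OF assms(1)])
  then show ?thesis by (rule frechet_derivative_at[symmetric])
qed

lemma frechet_derivative_wirtinger_cplx:
  assumes "smooth_on U r" and "open U" and "p \<in> U"
  shows "frechet_derivative (d_z (cplx r)) (at p) = (\<lambda>u. (of_real (second_deriv r p u (1, 0))
      + (- \<i>) * of_real (second_deriv r p u (\<i>, 0))) / 2)"
    and "frechet_derivative (d_zbar (cplx r)) (at p) = (\<lambda>u. (of_real (second_deriv r p u (1, 0))
      + \<i> * of_real (second_deriv r p u (\<i>, 0))) / 2)"
    and "frechet_derivative (d_wbar (cplx r)) (at p) = (\<lambda>u. (of_real (second_deriv r p u (0, 1))
      + \<i> * of_real (second_deriv r p u (0, \<i>))) / 2)"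
  using frechet_derivative_deriv_cplx[OF assms, of "(1, 0)" "- \<i>" "(\<i>, 0)"]
    frechet_derivative_deriv_cplx[OF assms, of "(1, 0)" "\<i>" "(\<i>, 0)"]
    frechet_derivative_deriv_cplx[OF assms, of "(0, 1)" "\<i>" "(0, \<i>)"]
  by (simp_all add: d_z_def[abs_def] d_zbar_def[abs_def] d_wbar_def[abs_def]
      coef_z_def coef_zbar_def coef_wbar_def)

text \<open>On the complex line through \<open>p\<close> in direction \<open>A p\<close>, the mixed
  Wirtinger derivative is a quarter of the Laplacian. Symmetry of the second derivative removes the
  imaginary part.\<close>

lemma hess_cplx:
  assumes "smooth_on U r" and "open U" and "p \<in> U"
  shows "hess (cplx r) A A p = of_real ((second_deriv r p (A p) (A p)
    + second_deriv r p (mult_i (A p)) (mult_i (A p))) / 4)"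
proof -
  interpret B: bounded_bilinear "second_deriv r p"
    by (rule bounded_bilinear_second_deriv[OF assms])
  note sym = second_deriv_sym[OF assms]
  have s: "second_deriv r p (\<i>, 0) (1, 0) = second_deriv r p (1, 0) (\<i>, 0)"
    "second_deriv r p (0, 1) (1, 0) = second_deriv r p (1, 0) (0, 1)"
    "second_deriv r p (0, \<i>) (1, 0) = second_deriv r p (1, 0) (0, \<i>)"
    "second_deriv r p (0, 1) (\<i>, 0) = second_deriv r p (\<i>, 0) (0, 1)"
    "second_deriv r p (0, \<i>) (\<i>, 0) = second_deriv r p (\<i>, 0) (0, \<i>)"
    "second_deriv r p (0, \<i>) (0, 1) = second_deriv r p (0, 1) (0, \<i>)"
    by (rule sym)+
  note expand = B.add_left B.add_right B.scaleR_left B.scaleR_right s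
  define a b where "a = fst (A p)" and "b = snd (A p)"
  have l: "A p = Re a *\<^sub>R (1, 0) + Im a *\<^sub>R (\<i>, 0) + Re b *\<^sub>R (0, 1) + Im b *\<^sub>R (0, \<i>)"
    unfolding a_def b_def by (rule C2_decompose)
  have il: "mult_i (A p) = (- Im a) *\<^sub>R (1, 0) + Re a *\<^sub>R (\<i>, 0) + (- Im b) *\<^sub>R (0, 1) + Re b *\<^sub>R (0, \<i>)"
    unfolding a_def b_def by (rule mult_i_decompose)
  have "hess (cplx r) A A p =
     coef_z (frechet_derivative (d_zbar (cplx r)) (at p)) * a * cnj a +
     coef_z (frechet_derivative (d_wbar (cplx r)) (at p)) * a * cnj b +
     coef_w (frechet_derivative (d_zbar (cplx r)) (at p)) * b * cnj a +
     coef_w (frechet_derivative (d_wbar (cplx r)) (at p)) * b * cnj b"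
    by (simp add: hess_def a_def b_def d_z_def d_w_def)
  also have "\<dots> = of_real ((second_deriv r p (A p) (A p)
    + second_deriv r p (mult_i (A p)) (mult_i (A p))) / 4)"
    unfolding frechet_derivative_wirtinger_cplx[OF assms] coef_z_def coef_w_def il unfolding l
    by (simp only: expand) (simp add: complex_eq_iff field_simps)
  finally show ?thesis .
qed

lemma bounded_linear_mult_i: "bounded_linear mult_i"
  unfolding mult_i_def[abs_def]
  by (intro bounded_linear_Pair bounded_linear_compose[OF bounded_linear_mult_right]
      bounded_linear_fst bounded_linear_snd)

lemma smooth_on_wirtinger:
  assumes "open W" and "smooth_on W f"
  shows "smooth_on W (d_z f)" and "smooth_on W (d_w f)"
    and "smooth_on W (d_zbar f)" and "smooth_on W (d_wbar f)"
proof -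
  have *: "smooth_on W (\<lambda>x. (frechet_derivative f (at x) a + k * frechet_derivative f (at x) b) / 2)"
    for a b k
    by (intro smooth_on_bounded_linear[OF _ _ bounded_linear_divide] smooth_on_add
        smooth_on_bounded_linear[OF _ _ bounded_linear_mult_right] smooth_on_deriv assms)
  show "smooth_on W (d_z f)" "smooth_on W (d_w f)" "smooth_on W (d_zbar f)" "smooth_on W (d_wbar f)"
    using *[of "(1, 0)" "- \<i>" "(\<i>, 0)"] *[of "(0, 1)" "- \<i>" "(0, \<i>)"]
      *[of "(1, 0)" "\<i>" "(\<i>, 0)"] *[of "(0, 1)" "\<i>" "(0, \<i>)"]
    by (simp_all add: d_z_def[abs_def] d_w_def[abs_def] d_zbar_def[abs_def] d_wbar_def[abs_def]
        coef_z_def coef_w_def coef_zbar_def coef_wbar_def)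
qed

lemma smooth_on_hess:
  assumes "open W" and "smooth_on W f" and "smooth_on W L"
  shows "smooth_on W (hess f L L)"
proof -
  have "smooth_on W (\<lambda>p. fst (L p))" "smooth_on W (\<lambda>p. snd (L p))"
    by (intro smooth_on_bounded_linear[OF assms(1,3)] bounded_linear_fst bounded_linear_snd)+
  moreover from this have "smooth_on W (\<lambda>p. cnj (fst (L p)))" "smooth_on W (\<lambda>p. cnj (snd (L p)))"
    by (auto intro: smooth_on_bounded_linear[OF assms(1) _ bounded_linear_cnj])
  ultimately show ?thesis
    unfolding hess_def[abs_def]
    by (intro smooth_on_add smooth_on_mult smooth_on_wirtinger assms(1,2))
qed

text \<open>Replaces the derivative selected inside \<open>vf\<close> and \<open>vf_bar\<close> by
  any convenient one: only its values at \<open>L p\<close> and \<open>mult_i (L p)\<close> enter,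
  and these are unique on the tangent cone.\<close>

lemma vf_within:
  assumes "(f has_derivative D) (at p within S)"
    and "L p \<in> tangent_cone S p" and "mult_i (L p) \<in> tangent_cone S p"
  shows "vf L S f p = (D (L p) + (- \<i>) * D (mult_i (L p))) / 2"
    and "vf_bar L S f p = (D (L p) + \<i> * D (mult_i (L p))) / 2"
proof -
  define D' where "D' = frechet_derivative f (at p within S)"
  have der: "(f has_derivative D') (at p within S)"
    unfolding D'_def using assms(1) frechet_derivative_works differentiable_def by blast
  have eq: "D' (L p) = D (L p)" "D' (mult_i (L p)) = D (mult_i (L p))"
    using tangent_cone_derivative_unique[OF der assms(1)] assms(2,3) by blast+
  show "vf L S f p = (D (L p) + (- \<i>) * D (mult_i (L p))) / 2"
    using coef_sum[OF has_derivative_linear[OF der], of "L p"] eq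
    by (simp add: vf_def Let_def flip: D'_def)
  show "vf_bar L S f p = (D (L p) + \<i> * D (mult_i (L p))) / 2"
    using coef_bar_sum[OF has_derivative_linear[OF der], of "L p"] eq
    by (simp add: vf_bar_def Let_def flip: D'_def)
qed

lemma vf_cplx_eq_0_iff:
  assumes "smooth_on U r" and "q \<in> U"
  shows "vf L UNIV (cplx r) q = 0 \<longleftrightarrow>
    frechet_derivative r (at q) (L q) = 0 \<and> frechet_derivative r (at q) (mult_i (L q)) = 0"
proof -
  have "(cplx r has_derivative (\<lambda>v. of_real (frechet_derivative r (at q) v))) (at q)"
    by (rule bounded_linear.has_derivative[OF bounded_linear_of_real smooth_on_has_derivative[OF assms]])
  from coef_sum[OF has_derivative_linear[OF this], of "L q"]
  have "vf L UNIV (cplx r) q = (of_real (frechet_derivative r (at q) (L q))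
      - \<i> * of_real (frechet_derivative r (at q) (mult_i (L q)))) / 2"
    by (simp add: vf_def Let_def frechet_derivative_cplx[OF assms])
  then show ?thesis by (auto simp: complex_eq_iff)
qed

text \<open>A product rule. Expanding the field in the basis reduces it to derivatives of
  \<open>f\<close> in fixed directions with varying coefficients.\<close>

lemma has_derivative_along_field:
  fixes f :: "'a::euclidean_space \<Rightarrow> real"
  assumes f: "smooth_on W f" and "open W" and "p \<in> W" and X: "(X has_derivative X') (at p)"
  shows "((\<lambda>x. frechet_derivative f (at x) (X x)) has_derivative
    (\<lambda>u. second_deriv f p u (X p) + frechet_derivative f (at p) (X' u))) (at p)"
proof -
  interpret B: bounded_bilinear "second_deriv f p"
    by (rule bounded_bilinear_second_deriv[OF assms(1-3)])
  have expand: "T v = (\<Sum>b\<in>Basis. (v \<bullet> b) * T b)" if lin: "linear T" for T :: "'a \<Rightarrow> real" and v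
  proof -
    have "T v = T (\<Sum>b\<in>Basis. (v \<bullet> b) *\<^sub>R b)" by (simp only: euclidean_representation)
    also have "\<dots> = (\<Sum>b\<in>Basis. (v \<bullet> b) * T b)"
      by (simp only: linear_sum[OF lin] linear_scale[OF lin] real_scaleR_def)
    finally show ?thesis .
  qed
  have "((\<lambda>x. \<Sum>b\<in>Basis. (X x \<bullet> b) * frechet_derivative f (at x) b) has_derivative
    (\<lambda>u. \<Sum>b\<in>Basis. (X p \<bullet> b) * second_deriv f p u b + (X' u \<bullet> b) * frechet_derivative f (at p) b)) (at p)"
    by (intro has_derivative_sum has_derivative_mult has_second_deriv[OF assms(1,3)]
        has_derivative_inner_left X)
  moreover have "(\<Sum>b\<in>Basis. (X p \<bullet> b) * second_deriv f p u b + (X' u \<bullet> b) * frechet_derivative f (at p) b)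
      = second_deriv f p u (X p) + frechet_derivative f (at p) (X' u)" for u
    unfolding sum.distrib
    using expand[OF bounded_linear.linear[OF B.bounded_linear_right], of u "X p"]
      expand[OF linear_frechet_derivative[OF f assms(3)], of "X' u"] by simp
  ultimately have "((\<lambda>x. \<Sum>b\<in>Basis. (X x \<bullet> b) * frechet_derivative f (at x) b) has_derivative
      (\<lambda>u. second_deriv f p u (X p) + frechet_derivative f (at p) (X' u))) (at p)" by simp
  then show ?thesis
    by (rule has_derivative_transform_within_open[OF _ assms(2,3)])
      (simp only: expand[OF linear_frechet_derivative[OF f], symmetric])
qed

text \<open>Pseudoconvexity supplies some defining function \<open>r'\<close>, not the given
  \<open>r\<close>. Proportional differentials make \<open>L\<close> tangential for
  \<open>r'\<close> as well, and on tangent vectors the second derivatives differ by a positive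
  factor.\<close>

lemma levi_form_nonneg:
  assumes "open \<Omega>" and "pseudoconvex_at \<Omega> p" and ld: "local_defining \<Omega> p U r"
    and L: "holo_tangential \<Omega> p U r V L"
  obtains N where "open N" and "p \<in> N" and "N \<subseteq> U \<inter> V"
    and "\<And>q. q \<in> frontier \<Omega> \<inter> N \<Longrightarrow>
      0 \<le> second_deriv r q (L q) (L q) + second_deriv r q (mult_i (L q)) (mult_i (L q))"
proof -
  obtain U' r' where ld': "local_defining \<Omega> p U' r'"
    and psc: "\<And>V L. holo_tangential \<Omega> p U' r' V L \<Longrightarrow>
        \<forall>\<^sub>F q in nhds p. q \<in> frontier \<Omega> \<longrightarrow> 0 \<le> hess (cplx r') L L q"
    using assms(2) unfolding pseudoconvex_at_def by blast
  note lds = ld[unfolded local_defining_def] ld'[unfolded local_defining_def]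
  note Ls = L[unfolded holo_tangential_def]
  have tan: "frechet_derivative r (at q) (L q) = 0" "frechet_derivative r (at q) (mult_i (L q)) = 0"
    if "q \<in> frontier \<Omega>" "q \<in> U" "q \<in> V" for q
    using Ls lds vf_cplx_eq_0_iff[of U r q L] that by blast+
  \<comment> \<open>The domain shrinks to \<open>U \<inter> V\<close> because tangency of
    \<open>L\<close> with respect to \<open>r\<close> is known only at boundary points
    there.\<close>
  have "holo_tangential \<Omega> p U' r' (U \<inter> V) L"
    unfolding holo_tangential_def
  proof (intro conjI ballI)
    show "open (U \<inter> V)" "p \<in> U \<inter> V" using Ls lds by auto
    show "smooth_on (U \<inter> V) L" using Ls smooth_on_subset by blast
    fix q assume q: "q \<in> frontier \<Omega> \<inter> U' \<inter> (U \<inter> V)"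
    then have q': "q \<in> frontier \<Omega>" "q \<in> U" "q \<in> U'" by auto
    obtain c where "\<And>v. frechet_derivative r' (at q) v = c * frechet_derivative r (at q) v"
      by (rule local_defining_proportional[OF assms(1) ld ld' q']) (rule that)
    then show "vf L UNIV (cplx r') q = 0"
      using tan[of q] q lds vf_cplx_eq_0_iff[of U' r' q L] by simp
  qed
  from psc[OF this] obtain N where N: "open N" "p \<in> N"
    "\<And>q. q \<in> N \<Longrightarrow> q \<in> frontier \<Omega> \<Longrightarrow> 0 \<le> hess (cplx r') L L q"
    unfolding eventually_nhds by blast
  show ?thesis
  proof (rule that[of "N \<inter> U \<inter> V \<inter> U'"])
    show "open (N \<inter> U \<inter> V \<inter> U')" "p \<in> N \<inter> U \<inter> V \<inter> U'" using N Ls lds by auto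
    fix q assume q: "q \<in> frontier \<Omega> \<inter> (N \<inter> U \<inter> V \<inter> U')"
    then have q': "q \<in> frontier \<Omega>" "q \<in> U" "q \<in> U'" by auto
    obtain c where "c > 0" and
      c: "\<And>v. frechet_derivative r (at q) v = 0 \<Longrightarrow> second_deriv r' q v v = c * second_deriv r q v v"
      by (rule local_defining_proportional[OF assms(1) ld ld' q']) (rule that)
    have r': "smooth_on U' r'" "open U'" "q \<in> U'" using lds q by auto
    have "0 \<le> hess (cplx r') L L q" using N(3) q by blast
    then have "0 \<le> second_deriv r' q (L q) (L q) + second_deriv r' q (mult_i (L q)) (mult_i (L q))"
      unfolding hess_cplx[OF r'] by (simp add: less_eq_complex_def)
    also have "\<dots> = c * (second_deriv r q (L q) (L q) + second_deriv r q (mult_i (L q)) (mult_i (L q)))"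
      using c tan[of q] q by (simp add: distrib_left)
    finally show "0 \<le> second_deriv r q (L q) (L q) + second_deriv r q (mult_i (L q)) (mult_i (L q))"
      using \<open>c > 0\<close> by (simp add: zero_le_mult_iff)
  qed auto
qed

text \<open>Failure of strictness applies to every defining function, in particular to
  \<open>r\<close>, and provides some field \<open>L\<close>. Were its Levi form positive at
  \<open>p\<close>, continuity would make it positive nearby.\<close>

lemma levi_form_nonpos:
  assumes "weakly_pseudoconvex_at \<Omega> p" and ld: "local_defining \<Omega> p U r"
  obtains V L where "holo_tangential \<Omega> p U r V L" and "nonvanishing_on V L"
    and "second_deriv r p (L p) (L p) + second_deriv r p (mult_i (L p)) (mult_i (L p)) \<le> 0"
proof -
  obtain V L where L: "holo_tangential \<Omega> p U r V L" "nonvanishing_on V L"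
    and nev: "\<not> (\<forall>\<^sub>F q in nhds p. q \<in> frontier \<Omega> \<longrightarrow> 0 < hess (cplx r) L L q)"
    using assms unfolding weakly_pseudoconvex_at_def strictly_pseudoconvex_at_def by blast
  note lds = ld[unfolded local_defining_def]
  note Ls = L(1)[unfolded holo_tangential_def]
  define W where "W = U \<inter> V"
  have W: "open W" "p \<in> W" "smooth_on W r" "smooth_on W L"
    using lds Ls smooth_on_subset by (auto simp: W_def intro: smooth_on_subset)
  define F where "F q = Re (hess (cplx r) L L q)" for q
  have F: "hess (cplx r) L L q = of_real (F q)" if "q \<in> W" for q
    unfolding F_def hess_cplx[OF W(3,1) that] by simp
  have "smooth_on W F"
    unfolding F_def
    by (intro smooth_on_bounded_linear[OF W(1) _ bounded_linear_Re] smooth_on_hess W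
        smooth_on_bounded_linear[OF W(1) _ bounded_linear_of_real])
  then have cont: "isCont F p"
    using W smooth_on_imp_continuous_on continuous_on_eq_continuous_at by blast
  have "F p \<le> 0"
  proof (rule ccontr)
    assume "\<not> F p \<le> 0"
    then have "\<forall>\<^sub>F q in nhds p. F q > 0"
      using order_tendstoD(1)[OF cont[unfolded isCont_def tendsto_at_iff_tendsto_nhds]] by simp
    moreover have "\<forall>\<^sub>F q in nhds p. q \<in> W" using W by (simp add: eventually_nhds_in_open)
    ultimately have "\<forall>\<^sub>F q in nhds p. q \<in> frontier \<Omega> \<longrightarrow> 0 < hess (cplx r) L L q"
      by eventually_elim (simp add: F less_complex_def)
    with nev show False by blast
  qed
  then have "second_deriv r p (L p) (L p) + second_deriv r p (mult_i (L p)) (mult_i (L p)) \<le> 0"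
    unfolding F_def hess_cplx[OF W(3,1,2)] by simp
  with that L show ?thesis by blast
qed

section \<open>Quadratic forms in the plane\<close>

definition plane_form :: "real \<Rightarrow> real \<Rightarrow> real \<Rightarrow> complex \<Rightarrow> real" where
  "plane_form P Q R z = P * (Re z)\<^sup>2 + 2 * Q * Re z * Im z + R * (Im z)\<^sup>2"

text \<open>Splits the form into its rotation invariant part, given by the trace, and its trace-free
  part, using that \<open>z\<^sup>2\<close> has real part
  \<open>(Re z)\<^sup>2 - (Im z)\<^sup>2\<close> and imaginary part
  \<open>2 * Re z * Im z\<close>.\<close>

lemma plane_form_eq:
  "2 * plane_form P Q R z = (P + R) * (cmod z)\<^sup>2 + Re (Complex (P - R) (- 2 * Q) * z\<^sup>2)"
  unfolding cmod_power2 by (simp add: plane_form_def power2_eq_square algebra_simps)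

lemma plane_form_scale: "plane_form P Q R (of_real t * z) = t\<^sup>2 * plane_form P Q R z"
  by (simp add: plane_form_def power2_eq_square algebra_simps)

text \<open>The minimum of the form on the unit circle is half of
  \<open>P + R - cmod (Complex (P - R) (- 2 * Q))\<close>.\<close>

lemma plane_form_pos_iff:
  "cmod (Complex (P - R) (- 2 * Q)) < P + R \<longleftrightarrow>
    (\<exists>\<epsilon>>0. \<forall>z. \<epsilon> * (cmod z)\<^sup>2 \<le> plane_form P Q R z)"
proof -
  define c where "c = Complex (P - R) (- 2 * Q)"
  have eq: "2 * plane_form P Q R z = (P + R) * (cmod z)\<^sup>2 + Re (c * z\<^sup>2)" for z
    unfolding c_def by (rule plane_form_eq)
  show ?thesis
    unfolding c_def[symmetric]
  proof
    assume less: "cmod c < P + R"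
    have "(P + R - cmod c) / 2 * (cmod z)\<^sup>2 \<le> plane_form P Q R z" for z
    proof -
      have "- Re (c * z\<^sup>2) \<le> cmod c * (cmod z)\<^sup>2"
        using abs_Re_le_cmod[of "c * z\<^sup>2"] by (simp add: norm_mult norm_power)
      with eq[of z] show ?thesis by (simp add: field_simps)
    qed
    with less show "\<exists>\<epsilon>>0. \<forall>z. \<epsilon> * (cmod z)\<^sup>2 \<le> plane_form P Q R z"
      by (intro exI[of _ "(P + R - cmod c) / 2"]) auto
  next
    assume "\<exists>\<epsilon>>0. \<forall>z. \<epsilon> * (cmod z)\<^sup>2 \<le> plane_form P Q R z"
    then obtain \<epsilon> where "\<epsilon> > 0" and ge: "\<And>z. \<epsilon> * (cmod z)\<^sup>2 \<le> plane_form P Q R z" by blast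
    show "cmod c < P + R"
    proof (cases "c = 0")
      case True
      then show ?thesis using ge[of 1] eq[of 1] \<open>\<epsilon> > 0\<close> by simp
    next
      case False
      \<comment> \<open>The direction of the minimum: here \<open>c * z\<^sup>2\<close> is the
        negative real number \<open>- (cmod c)\<^sup>2\<close>.\<close>
      define z where "z = csqrt (- cnj c)"
      have z2: "z\<^sup>2 = - cnj c" by (simp add: z_def)
      then have n: "(cmod z)\<^sup>2 = cmod c" by (metis norm_power norm_minus_cancel complex_mod_cnj)
      have "Re (c * z\<^sup>2) = - (cmod c)\<^sup>2"
        unfolding z2 cmod_power2 by (simp add: power2_eq_square)
      with eq[of z] ge[of z] n have "2 * \<epsilon> * cmod c \<le> (P + R - cmod c) * cmod c"
        by (simp add: algebra_simps power2_eq_square)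
      then have "2 * \<epsilon> \<le> P + R - cmod c" using False by simp
      with \<open>\<epsilon> > 0\<close> show ?thesis by simp
    qed
  qed
qed

text \<open>Half of \<epsilon> absorbs both remainders near 0, and homogeneity spreads the resulting
  bound from a small disc to the whole plane.\<close>

lemma quadratic_lower_bound_iff:
  fixes f q :: "complex \<Rightarrow> real"
  assumes q: "\<And>t z. q (of_real t * z) = t\<^sup>2 * q z"
    and f: "(\<lambda>z. f z - q z) \<in> o[at 0](\<lambda>z. (cmod z)\<^sup>2)"
  shows "(\<exists>\<epsilon>>0. \<exists>g. g \<in> o[at 0](\<lambda>z. (cmod z)\<^sup>2) \<and>
      (\<forall>\<^sub>F z in at 0. \<epsilon> * (cmod z)\<^sup>2 + g z \<le> f z)) \<longleftrightarrow> (\<exists>\<epsilon>>0. \<forall>z. \<epsilon> * (cmod z)\<^sup>2 \<le> q z)"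
proof
  assume "\<exists>\<epsilon>>0. \<forall>z. \<epsilon> * (cmod z)\<^sup>2 \<le> q z"
  then obtain \<epsilon> where "\<epsilon> > 0" "\<And>z. \<epsilon> * (cmod z)\<^sup>2 \<le> q z" by blast
  \<comment> \<open>The remainder is the difference of \<open>f\<close> and \<open>q\<close>
    itself.\<close>
  with f show "\<exists>\<epsilon>>0. \<exists>g. g \<in> o[at 0](\<lambda>z. (cmod z)\<^sup>2) \<and>
      (\<forall>\<^sub>F z in at 0. \<epsilon> * (cmod z)\<^sup>2 + g z \<le> f z)"
    by (intro exI[of _ \<epsilon>] conjI exI[of _ "\<lambda>z. f z - q z"]) auto
next
  assume "\<exists>\<epsilon>>0. \<exists>g. g \<in> o[at 0](\<lambda>z. (cmod z)\<^sup>2) \<and>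
      (\<forall>\<^sub>F z in at 0. \<epsilon> * (cmod z)\<^sup>2 + g z \<le> f z)"
  then obtain \<epsilon> g where "\<epsilon> > 0" and g: "g \<in> o[at 0](\<lambda>z. (cmod z)\<^sup>2)"
    and ev: "\<forall>\<^sub>F z in at 0. \<epsilon> * (cmod z)\<^sup>2 + g z \<le> f z" by blast
  have "(\<lambda>z. (f z - q z) - g z) \<in> o[at 0](\<lambda>z. (cmod z)\<^sup>2)"
    by (rule sum_in_smallo(2)[OF f g])
  from landau_o.smallD[OF this, of "\<epsilon> / 2"] \<open>\<epsilon> > 0\<close>
  have "\<forall>\<^sub>F z in at 0. norm ((f z - q z) - g z) \<le> \<epsilon> / 2 * norm ((cmod z)\<^sup>2)" by simp
  with ev have "\<forall>\<^sub>F z in at 0. \<epsilon> / 2 * (cmod z)\<^sup>2 \<le> q z"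
  proof eventually_elim
    case (elim z)
    then show ?case by (simp add: abs_le_iff) argo
  qed
  then obtain d where "d > 0" and d: "\<And>z. z \<noteq> 0 \<Longrightarrow> cmod z < d \<Longrightarrow> \<epsilon> / 2 * (cmod z)\<^sup>2 \<le> q z"
    unfolding eventually_at by auto
  have "\<epsilon> / 2 * (cmod z)\<^sup>2 \<le> q z" for z
  proof (cases "z = 0")
    case True
    then show ?thesis using q[of 0 0] by simp
  next
    case False
    \<comment> \<open>Scales \<open>z\<close> to modulus \<open>d / 2\<close>, inside the disc where
      the bound is known.\<close>
    define t where "t = d / 2 / cmod z"
    have t: "t > 0" using \<open>d > 0\<close> False by (simp add: t_def)
    have "cmod (of_real t * z) = t * cmod z" using t by (simp add: norm_mult)
    also have "\<dots> < d" using \<open>d > 0\<close> False by (simp add: t_def)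
    finally have "cmod (of_real t * z) < d" .
    moreover have "of_real t * z \<noteq> 0" using t False by simp
    ultimately have "\<epsilon> / 2 * (cmod (of_real t * z))\<^sup>2 \<le> t\<^sup>2 * q z"
      using d q by metis
    then have "t\<^sup>2 * (\<epsilon> / 2 * (cmod z)\<^sup>2) \<le> t\<^sup>2 * q z"
      by (simp add: norm_mult power_mult_distrib mult_ac)
    then show ?thesis using t by simp
  qed
  with \<open>\<epsilon> > 0\<close> show "\<exists>\<epsilon>>0. \<forall>z. \<epsilon> * (cmod z)\<^sup>2 \<le> q z"
    by (intro exI[of _ "\<epsilon> / 2"]) auto
qed

section \<open>Second derivatives along tangential fields\<close>

text \<open>Since \<open>lam\<close> is given by \<open>F\<close> only on \<open>S\<close>, all
  derivatives are taken within \<open>S\<close>. Differentiating the derivative of \<open>F\<close>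
  along \<open>L\<close> once more yields second derivatives of \<open>F\<close> and terms with the
  derivative of \<open>L\<close>; the assumptions \<open>flat\<close> remove the latter.\<close>

lemma second_tangential_derivatives:
  fixes L :: "C2 \<Rightarrow> C2" and F :: "C2 \<Rightarrow> real"
  assumes W: "open W" and p: "p \<in> S" "p \<in> W" and F: "smooth_on W F" and L: "smooth_on W L"
    and cone: "\<And>q. q \<in> S \<Longrightarrow> q \<in> W \<Longrightarrow> L q \<in> tangent_cone S q"
      "\<And>q. q \<in> S \<Longrightarrow> q \<in> W \<Longrightarrow> mult_i (L q) \<in> tangent_cone S q"
    and lam: "\<And>q. q \<in> S \<Longrightarrow> q \<in> W \<Longrightarrow> lam q = complex_of_real (F q)"
    and flat: "\<And>u. u \<in> {L p, mult_i (L p)} \<Longrightarrow>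
        frechet_derivative F (at p) (frechet_derivative L (at p) u) = 0"
      "\<And>u. u \<in> {L p, mult_i (L p)} \<Longrightarrow>
        frechet_derivative F (at p) (mult_i (frechet_derivative L (at p) u)) = 0"
  defines "P \<equiv> second_deriv F p (L p) (L p)"
    and "Q \<equiv> second_deriv F p (L p) (mult_i (L p))"
    and "R \<equiv> second_deriv F p (mult_i (L p)) (mult_i (L p))"
  shows "vf L S (vf_bar L S lam) p = of_real ((P + R) / 4)"
    and "vf L S (vf L S lam) p = Complex (P - R) (- 2 * Q) / 4"
proof -
  have ev: "\<forall>\<^sub>F q in at p within S. q \<in> S \<and> q \<in> W"
    using W p(2) unfolding eventually_at_topological by (intro exI[of _ W]) auto
  have der_lam: "(lam has_derivative (\<lambda>v. complex_of_real (frechet_derivative F (at q) v))) (at q within S)"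
    if q: "q \<in> S" "q \<in> W" for q
  proof (rule has_derivative_transform_eventually)
    show "((\<lambda>x. complex_of_real (F x)) has_derivative
        (\<lambda>v. complex_of_real (frechet_derivative F (at q) v))) (at q within S)"
      by (rule has_derivative_at_withinI[OF bounded_linear.has_derivative[OF bounded_linear_of_real
            smooth_on_has_derivative[OF F q(2)]]])
    have "\<forall>\<^sub>F x in at q within S. x \<in> S \<and> x \<in> W"
      using W q unfolding eventually_at_topological by (intro exI[of _ W]) auto
    then show "\<forall>\<^sub>F x in at q within S. complex_of_real (F x) = lam x"
      by eventually_elim (simp add: lam)
  qed (use q lam in auto)
  have first: "vf L S lam q = (of_real (frechet_derivative F (at q) (L q))
        + (- \<i>) * of_real (frechet_derivative F (at q) (mult_i (L q)))) / 2"
      "vf_bar L S lam q = (of_real (frechet_derivative F (at q) (L q))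
        + \<i> * of_real (frechet_derivative F (at q) (mult_i (L q)))) / 2"
    if q: "q \<in> S" "q \<in> W" for q
    by (rule vf_within[where f = lam and L = L and p = q, OF der_lam[OF q] cone(1)[OF q] cone(2)[OF q]])+
  note derL = smooth_on_has_derivative[OF L p(2)]
  \<comment> \<open>The scalar \<open>k\<close> is \<open>\<i>\<close> for \<open>vf_bar\<close> and
    \<open>- \<i>\<close> for \<open>vf\<close>.\<close>
  have inner: "((\<lambda>q. (complex_of_real (frechet_derivative F (at q) (L q))
        + k * complex_of_real (frechet_derivative F (at q) (mult_i (L q)))) / 2) has_derivative
      (\<lambda>u. (complex_of_real (second_deriv F p u (L p) + frechet_derivative F (at p) (frechet_derivative L (at p) u))
        + k * complex_of_real (second_deriv F p u (mult_i (L p))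
          + frechet_derivative F (at p) (mult_i (frechet_derivative L (at p) u)))) / 2)) (at p within S)" for k
    by (rule has_derivative_at_withinI) (intro bounded_linear.has_derivative[OF bounded_linear_divide]
        has_derivative_add bounded_linear.has_derivative[OF bounded_linear_mult_right]
        bounded_linear.has_derivative[OF bounded_linear_of_real]
        has_derivative_along_field[OF F W p(2)] bounded_linear.has_derivative[OF bounded_linear_mult_i]
        derL)
  \<comment> \<open>With this symmetry the two mixed terms cancel in the first formula and add up to
    \<open>2 * Q\<close> in the second.\<close>
  have sym: "second_deriv F p (mult_i (L p)) (L p) = Q"
    unfolding Q_def by (rule second_deriv_sym[OF F W p(2)])
  have "(vf_bar L S lam has_derivative
      (\<lambda>u. (complex_of_real (second_deriv F p u (L p) + frechet_derivative F (at p) (frechet_derivative L (at p) u))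
        + \<i> * complex_of_real (second_deriv F p u (mult_i (L p))
          + frechet_derivative F (at p) (mult_i (frechet_derivative L (at p) u)))) / 2)) (at p within S)"
    by (rule has_derivative_transform_eventually[OF inner eventually_mono[OF ev]])
      (use p first(2) in auto)
  from vf_within(1)[where f = "vf_bar L S lam" and L = L and p = p, OF this cone[OF p]]
  show "vf L S (vf_bar L S lam) p = of_real ((P + R) / 4)"
    by (simp add: flat sym flip: P_def Q_def R_def) (simp add: complex_eq_iff field_simps)
  have "(vf L S lam has_derivative
      (\<lambda>u. (complex_of_real (second_deriv F p u (L p) + frechet_derivative F (at p) (frechet_derivative L (at p) u))
        + (- \<i>) * complex_of_real (second_deriv F p u (mult_i (L p))
          + frechet_derivative F (at p) (mult_i (frechet_derivative L (at p) u)))) / 2)) (at p within S)"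
    by (rule has_derivative_transform_eventually[OF inner eventually_mono[OF ev]])
      (use p first(1) in auto)
  from vf_within(1)[where f = "vf L S lam" and L = L and p = p, OF this cone[OF p]]
  show "vf L S (vf L S lam) p = Complex (P - R) (- 2 * Q) / 4"
    by (simp add: flat sym flip: P_def Q_def R_def) (simp add: complex_eq_iff field_simps)
qed

section \<open>The complex tangent line at the origin and the equivalence\<close>

lemma complex_tangent_snd_eq_0:
  fixes D :: "C2 \<Rightarrow> real"
  assumes lin: "linear D" and "D \<noteq> (\<lambda>v. 0)" and e: "D (1, 0) = 0" "D (\<i>, 0) = 0"
    and v: "D v = 0" "D (mult_i v) = 0"
  shows "snd v = 0"
proof -
  define x y where "x = Re (snd v)" and "y = Im (snd v)"
  define A B where "A = D (0, 1)" and "B = D (0, \<i>)"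
  have D: "D u = Re (snd u) * A + Im (snd u) * B" for u
    by (subst C2_decompose[of u])
      (simp only: linear_add[OF lin] linear_scale[OF lin] e real_scaleR_def A_def B_def; simp)
  \<comment> \<open>These are, up to sign, the real and imaginary parts of the product of
    \<open>snd v\<close> with the nonzero number \<open>Complex A (- B)\<close>.\<close>
  have 1: "x * A + y * B = 0" "x * B - y * A = 0"
    using v by (simp_all add: D mult_i_def x_def y_def)
  have "(x\<^sup>2 + y\<^sup>2) * A = x * (x * A + y * B) - y * (x * B - y * A)"
    "(x\<^sup>2 + y\<^sup>2) * B = y * (x * A + y * B) + x * (x * B - y * A)"
    by (simp_all add: algebra_simps power2_eq_square)
  then have "(x\<^sup>2 + y\<^sup>2) * A = 0" "(x\<^sup>2 + y\<^sup>2) * B = 0" unfolding 1 by simp_all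
  moreover have "A \<noteq> 0 \<or> B \<noteq> 0" using assms(2) D by auto
  ultimately have "x\<^sup>2 + y\<^sup>2 = 0" by auto
  then show ?thesis by (simp add: x_def y_def complex_eq_iff sum_power2_eq_zero_iff)
qed

lemma pairs_snd_0_decompose: "snd v = 0 \<Longrightarrow> v = Re (fst v) *\<^sub>R (1, 0) + Im (fst v) *\<^sub>R (\<i>, 0)"
  for v :: C2
  by (auto simp: prod_eq_iff complex_eq_iff)

theorem proposition4p16:
  fixes \<Omega> U V :: "C2 set" and r :: "C2 \<Rightarrow> real" and L :: "C2 \<Rightarrow> C2" and lam :: "C2 \<Rightarrow> complex"
  assumes "pseudoconvex_domain \<Omega>" and "smoothly_bounded \<Omega>"
    and "0 \<in> frontier \<Omega>" and "weakly_pseudoconvex_at \<Omega> 0"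
    and "local_defining \<Omega> 0 U r"
    and "holo_tangential \<Omega> 0 U r V L" and "nonvanishing_on V L"
    and "\<And>q. q \<in> frontier \<Omega> \<inter> U \<inter> V \<Longrightarrow> lam q = hess (cplx r) L L q"
    and "d_z (cplx r) 0 = 0" and "d_z (d_z (cplx r)) 0 = 0"
  shows "vf L (frontier \<Omega>) (vf_bar L (frontier \<Omega>) lam) 0
           > complex_of_real (cmod (vf L (frontier \<Omega>) (vf L (frontier \<Omega>) lam) 0))
     \<longleftrightarrow>
     (\<exists>\<epsilon>>0. \<exists>g :: complex \<Rightarrow> real. g \<in> o[at 0](\<lambda>z. (cmod z)\<^sup>2) \<and>
        (\<forall>\<^sub>F z in at 0.
           hess (cplx r) L L (z, 0) \<ge> complex_of_real (\<epsilon> * (cmod z)\<^sup>2 + g z)))"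
proof -

  \<comment> \<open>Tangency along the boundary\<close>
  define S where "S = frontier \<Omega>"
  define W where "W = U \<inter> V"
  have \<Omega>: "open \<Omega>" using assms(1) by (simp add: pseudoconvex_domain_def)
  note ld = assms(5)[unfolded local_defining_def]
  note Ls = assms(6)[unfolded holo_tangential_def]
  have W: "open W" "0 \<in> W" "smooth_on W r" "smooth_on W L"
    using ld Ls by (auto simp: W_def intro: smooth_on_subset)
  have tan: "frechet_derivative r (at q) (L q) = 0" "frechet_derivative r (at q) (mult_i (L q)) = 0"
    if "q \<in> S" "q \<in> W" for q
  proof -
    have "vf L UNIV (cplx r) q = 0" using Ls that unfolding S_def W_def by blast
    then show "frechet_derivative r (at q) (L q) = 0" "frechet_derivative r (at q) (mult_i (L q)) = 0"
      using vf_cplx_eq_0_iff[OF W(3) that(2)] by auto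
  qed
  have cone: "v \<in> tangent_cone S q" if "q \<in> S" "q \<in> W" "frechet_derivative r (at q) v = 0" for q v
    using local_defining_tangent_cone[OF \<Omega> assms(5), of q v] that by (simp add: S_def W_def)

  \<comment> \<open>A smooth real function on the whole neighborhood \<open>W\<close> that agrees
    with \<open>lam\<close> on the boundary.\<close>
  define F where "F q = Re (hess (cplx r) L L q)" for q
  have F_eq: "F q = (second_deriv r q (L q) (L q) + second_deriv r q (mult_i (L q)) (mult_i (L q))) / 4"
    if "q \<in> W" for q
    unfolding F_def hess_cplx[OF W(3,1) that] by simp
  have hess_F: "hess (cplx r) L L q = of_real (F q)" if "q \<in> W" for q
    unfolding F_def hess_cplx[OF W(3,1) that] by simp
  have smooth_F: "smooth_on W F"
    unfolding F_def
    by (intro smooth_on_bounded_linear[OF W(1) _ bounded_linear_Re] smooth_on_hess W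
        smooth_on_bounded_linear[OF W(1) _ bounded_linear_of_real])

  \<comment> \<open>First and second derivatives of the defining function at the origin\<close>
  define D where "D = frechet_derivative r (at 0)"
  have linD: "linear D" unfolding D_def by (rule linear_frechet_derivative[OF W(3,2)])
  have "0 \<in> S" using assms(3) by (simp add: S_def)
  have D0: "D \<noteq> (\<lambda>v. 0)" using ld unfolding D_def by blast
  have De: "D (1, 0) = 0" "D (\<i>, 0) = 0"
    using assms(9) unfolding d_z_def coef_z_def frechet_derivative_cplx[OF W(3,2)]
    by (simp_all add: D_def complex_eq_iff)
  have Dker: "D v = 0" if "snd v = 0" for v
    by (subst pairs_snd_0_decompose[OF that])
      (simp only: linear_add[OF linD] linear_scale[OF linD] De; simp)

  define H where "H = second_deriv r 0"
  interpret H: bounded_bilinear H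
    unfolding H_def by (rule bounded_bilinear_second_deriv[OF W(3,1,2)])
  have Hsym: "H u v = H v u" for u v
    unfolding H_def by (rule second_deriv_sym[OF W(3,1,2)])
  \<comment> \<open>For real \<open>r\<close>, the real part of the equation for the second
    \<open>z\<close>-derivative equates the two diagonal entries and the imaginary part kills the
    mixed one. So on the \<open>z\<close>-axis \<open>H\<close> is \<open>h\<close> times the
    Euclidean inner product.\<close>
  have H1: "H (1, 0) (1, 0) = H (\<i>, 0) (\<i>, 0)" "H (1, 0) (\<i>, 0) = 0"
    using assms(10) Hsym[of "(\<i>, 0)" "(1, 0)"]
    unfolding d_z_def[of "d_z _"] coef_z_def frechet_derivative_wirtinger_cplx(1)[OF W(3,1,2)]
    by (simp_all add: complex_eq_iff flip: H_def)
  define h where "h = H (1, 0) (1, 0)"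
  have Hz: "H (z, 0) (z', 0) = (Re z * Re z' + Im z * Im z') * h" for z z'
  proof -
    have *: "(z, 0) = Re z *\<^sub>R (1, 0) + Im z *\<^sub>R (\<i>, 0 :: complex)" for z
      by (auto simp: complex_eq_iff)
    show ?thesis
      by (subst *[of z], subst *[of z'])
        (simp only: H.add_left H.add_right H.scaleR_left H.scaleR_right Hsym[of "(\<i>, 0)" "(1, 0)"] H1
          real_scaleR_def h_def; simp add: algebra_simps)
  qed
  have levi: "H v v + H (mult_i v) (mult_i v) = 2 * (cmod (fst v))\<^sup>2 * h" if "snd v = 0" for v
  proof -
    have "v = (fst v, 0)" "mult_i v = (\<i> * fst v, 0)" using that by (auto simp: mult_i_def prod_eq_iff)
    then have "H v v + H (mult_i v) (mult_i v)
        = H (fst v, 0) (fst v, 0) + H (\<i> * fst v, 0) (\<i> * fst v, 0)" by simp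
    then show ?thesis unfolding Hz cmod_power2 by (simp add: algebra_simps power2_eq_square)
  qed
  have L0: "snd (L 0) = 0"
    using complex_tangent_snd_eq_0[OF linD D0 De] tan[OF \<open>0 \<in> S\<close> W(2)] by (simp add: D_def)
  define a where "a = fst (L 0)"
  have "a \<noteq> 0" "L 0 = (a, 0)" "mult_i (L 0) = (\<i> * a, 0)"
    using assms(7) Ls L0 by (auto simp: nonvanishing_on_def a_def prod_eq_iff mult_i_def)

  \<comment> \<open>Vanishing of the Levi form at the origin\<close>
  obtain N where N: "open N" "0 \<in> N" "N \<subseteq> W" and nonneg: "\<And>q. q \<in> S \<inter> N \<Longrightarrow> 0 \<le> F q"
  proof -
    have "pseudoconvex_at \<Omega> 0" using assms(4) by (simp add: weakly_pseudoconvex_at_def)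
    from levi_form_nonneg[OF \<Omega> this assms(5,6)] obtain N where N: "open N" "0 \<in> N" "N \<subseteq> W"
      and levi_ge: "\<And>q. q \<in> S \<inter> N \<Longrightarrow>
        0 \<le> second_deriv r q (L q) (L q) + second_deriv r q (mult_i (L q)) (mult_i (L q))"
      unfolding S_def W_def by blast
    have "0 \<le> F q" if "q \<in> S \<inter> N" for q
    proof -
      have "q \<in> W" using N(3) that by auto
      from F_eq[OF this] levi_ge[OF that] show ?thesis by simp
    qed
    with N that show ?thesis by blast
  qed
  \<comment> \<open>The field witnessing weak pseudoconvexity need not be \<open>L\<close>. At 0 it
    too is a nonzero vector on the \<open>z\<close>-axis, so its Levi form is a positive multiple of
    \<open>h\<close>.\<close>
  have "h \<le> 0"
  proof -
    obtain V' L' where L': "holo_tangential \<Omega> 0 U r V' L'" "nonvanishing_on V' L'"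
      "H (L' 0) (L' 0) + H (mult_i (L' 0)) (mult_i (L' 0)) \<le> 0"
      unfolding H_def by (rule levi_form_nonpos[OF assms(4,5)])
    have "0 \<in> V'" "vf L' UNIV (cplx r) 0 = 0"
      using L'(1) ld unfolding holo_tangential_def by blast+
    then have "D (L' 0) = 0" "D (mult_i (L' 0)) = 0"
      using vf_cplx_eq_0_iff[OF W(3,2)] by (auto simp: D_def)
    then have "snd (L' 0) = 0" by (rule complex_tangent_snd_eq_0[OF linD D0 De])
    moreover have "L' 0 \<noteq> 0" using L'(2) \<open>0 \<in> V'\<close> by (simp add: nonvanishing_on_def)
    ultimately have "fst (L' 0) \<noteq> 0" by (simp add: prod_eq_iff)
    with L'(3) levi[OF \<open>snd (L' 0) = 0\<close>] show ?thesis by (simp add: mult_le_0_iff)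
  qed
  moreover have F0: "F 0 = (cmod a)\<^sup>2 * h / 2"
    using F_eq[OF W(2)] levi[OF L0] by (simp add: a_def H_def mult.commute)
  moreover have "0 \<le> F 0" using nonneg[of 0] \<open>0 \<in> S\<close> N(2) by simp
  ultimately have "h \<le> 0" "0 \<le> (cmod a)\<^sup>2 * h" by simp_all
  then have "h = 0" using \<open>a \<noteq> 0\<close> by (auto simp: zero_le_mult_iff)
  then have "F 0 = 0" using F0 by simp
  have H0: "H u v = 0" if "snd u = 0" "snd v = 0" for u v
    using Hz[of "fst u" "fst v"] that \<open>h = 0\<close> by (metis mult_zero_right prod.collapse)

  \<comment> \<open>Vanishing of the first-order terms\<close>
  define D' where "D' = frechet_derivative F (at 0)"
  have derF: "(F has_derivative D') (at 0)"
    unfolding D'_def by (rule smooth_on_has_derivative[OF smooth_F W(2)])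
  have linD': "linear D'" using derF by (rule has_derivative_linear)
  have D'_ge: "0 \<le> D' v" if "D v = 0" for v
    using tangent_cone_derivative_nonneg[OF derF N(1,2) _ cone[of 0 v]] nonneg that \<open>F 0 = 0\<close>
      \<open>0 \<in> S\<close> W(2) by (simp add: D_def)
  \<comment> \<open>\<open>F\<close> has a minimum relative to the boundary at 0, and the tangent
    space contains \<open>- v\<close> along with \<open>v\<close>.\<close>
  have D'0: "D' v = 0" if "D v = 0" for v
    using D'_ge[of v] D'_ge[of "- v"] that
    by (simp add: linear_neg[OF linD] linear_neg[OF linD'])

  define L' where "L' = frechet_derivative L (at 0)"
  have derL: "(L has_derivative L') (at 0)"
    unfolding L'_def by (rule smooth_on_has_derivative[OF W(4,2)])
  \<comment> \<open>Differentiating the tangency of \<open>X\<close> along the boundary in direction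
    \<open>u\<close> gives \<open>H u (X 0) + D (X' u) = 0\<close>, whose first term vanishes by
    \<open>H0\<close>. It is applied to \<open>L\<close> and to \<open>mult_i\<close> of
    \<open>L\<close>.\<close>
  have DX: "D (X' u) = 0"
    if X: "(X has_derivative X') (at 0)" "\<And>q. q \<in> S \<inter> W \<Longrightarrow> frechet_derivative r (at q) (X q) = 0"
      "snd (X 0) = 0" and u: "snd u = 0" for X X' u
  proof -
    have "H u (X 0) + D (X' u) = 0"
      unfolding H_def D_def
      by (rule tangent_cone_derivative_zero[where S = S, OF has_derivative_along_field[OF W(3,1,2) X(1)] W(1,2)
            _ X(2)])
        (use X(2) \<open>0 \<in> S\<close> W(2) cone[of 0 u] Dker[OF u] in \<open>auto simp: D_def\<close>)
    with H0[OF u X(3)] show ?thesis by simp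
  qed
  have DL: "D (L' u) = 0" "D (mult_i (L' u)) = 0" if "snd u = 0" for u
    using DX[OF derL _ L0 that] DX[OF bounded_linear.has_derivative[OF bounded_linear_mult_i derL] _ _ that]
      tan L0 by (auto simp: mult_i_def)

  \<comment> \<open>The two second derivatives of the Levi form\<close>
  define P where "P = second_deriv F 0 (L 0) (L 0)"
  define Q where "Q = second_deriv F 0 (L 0) (mult_i (L 0))"
  define R where "R = second_deriv F 0 (mult_i (L 0)) (mult_i (L 0))"
  have lam_F: "lam q = complex_of_real (F q)" if "q \<in> S" "q \<in> W" for q
    using assms(8)[of q] hess_F[OF that(2)] that by (simp add: S_def W_def)
  have flat: "frechet_derivative F (at 0) (frechet_derivative L (at 0) u) = 0"
    "frechet_derivative F (at 0) (mult_i (frechet_derivative L (at 0) u)) = 0"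
    if "u \<in> {L 0, mult_i (L 0)}" for u
  proof -
    have "snd u = 0" using that L0 by (auto simp: mult_i_def)
    from this[THEN DL(1), THEN D'0] this[THEN DL(2), THEN D'0]
    show "frechet_derivative F (at 0) (frechet_derivative L (at 0) u) = 0"
      "frechet_derivative F (at 0) (mult_i (frechet_derivative L (at 0) u)) = 0"
      by (simp_all add: D'_def L'_def)
  qed
  have tangential: "vf L S (vf_bar L S lam) 0 = of_real ((P + R) / 4)"
    "vf L S (vf L S lam) 0 = Complex (P - R) (- 2 * Q) / 4"
    unfolding P_def Q_def R_def
    by (rule second_tangential_derivatives[OF W(1) \<open>0 \<in> S\<close> W(2) smooth_F W(4)
          cone[OF _ _ tan(1)] cone[OF _ _ tan(2)] lam_F flat]; assumption)+
  \<comment> \<open>Both sides are real, so the complex order is the real one; the common factor 1/4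
    drops out.\<close>
  have lhs: "vf L S (vf_bar L S lam) 0 > complex_of_real (cmod (vf L S (vf L S lam) 0))
      \<longleftrightarrow> cmod (Complex (P - R) (- 2 * Q)) < P + R"
    unfolding tangential by (simp add: norm_divide less_complex_def)

  \<comment> \<open>Expansion of the Levi form on the complex tangent line\<close>
  define q where "q z = plane_form P Q R (z / a) / 2" for z
  interpret F2: bounded_bilinear "second_deriv F 0"
    by (rule bounded_bilinear_second_deriv[OF smooth_F W(1,2)])
  \<comment> \<open>The entries \<open>P\<close>, \<open>Q\<close>, \<open>R\<close> refer to the
    real basis \<open>L 0\<close>, \<open>mult_i (L 0)\<close> of the \<open>z\<close>-axis, in
    which \<open>(z, 0)\<close> has the coordinates of \<open>z / a\<close>.\<close>
  have F2: "second_deriv F 0 (z, 0) (z, 0) = 2 * q z" for z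
  proof -
    define x where "x = z / a"
    have "z = x * a" using \<open>a \<noteq> 0\<close> by (simp add: x_def)
    then have "(z, 0) = Re x *\<^sub>R (a, 0 :: complex) + Im x *\<^sub>R (\<i> * a, 0)"
      by (simp add: complex_eq_iff)
    then have "(z, 0) = Re x *\<^sub>R L 0 + Im x *\<^sub>R mult_i (L 0)"
      unfolding \<open>mult_i (L 0) = (\<i> * a, 0)\<close> unfolding \<open>L 0 = (a, 0)\<close> .
    then have "second_deriv F 0 (z, 0) (z, 0) = plane_form P Q R x"
      unfolding P_def Q_def R_def plane_form_def
      by (simp only: F2.add_left F2.add_right F2.scaleR_left F2.scaleR_right
          second_deriv_sym[OF smooth_F W(1,2), of "mult_i (L 0)" "L 0"])
        (simp add: power2_eq_square algebra_simps)
    then show ?thesis by (simp add: q_def x_def)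
  qed
  have q_scale: "q (of_real t * z) = t\<^sup>2 * q z" for t z
    using plane_form_scale[of P Q R t "z / a"] by (simp add: q_def)
  have "(\<lambda>z. F (z, 0) - q z) \<in> o[at 0](\<lambda>z. (cmod z)\<^sup>2)"
  proof (rule landau_o.smallI)
    fix e :: real assume "e > 0"
    obtain d where "d > 0" and d: "\<And>v. norm v < d \<Longrightarrow> \<bar>F (0 + v) - F 0
      - frechet_derivative F (at 0) v - second_deriv F 0 v v / 2\<bar> \<le> e * (norm v)\<^sup>2"
      using second_order_Taylor[OF smooth_F W(1,2) \<open>e > 0\<close>] by blast
    have "norm (F (z, 0) - q z) \<le> e * norm ((cmod z)\<^sup>2)" if "cmod z < d" for z
    proof -
      \<comment> \<open>The point \<open>(z, 0)\<close> need not lie on the boundary, but as a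
        direction it is tangent at 0, so the linear Taylor term is absent.\<close>
      have "D' (z, 0) = 0" by (rule D'0[OF Dker]) simp
      with d[of "(z, 0)"] that F2[of z] \<open>F 0 = 0\<close> show ?thesis by (simp add: D'_def norm_Pair)
    qed
    then show "\<forall>\<^sub>F z in at 0. norm (F (z, 0) - q z) \<le> e * norm ((cmod z)\<^sup>2)"
      using \<open>d > 0\<close> unfolding eventually_at by auto
  qed
  note lower = quadratic_lower_bound_iff[OF q_scale this]
  \<comment> \<open>The substitution of \<open>z / a\<close> for \<open>z\<close> and the factor 1/2
    only change the constant.\<close>
  have "(\<exists>\<epsilon>>0. \<forall>z. \<epsilon> * (cmod z)\<^sup>2 \<le> q z) \<longleftrightarrow> (\<exists>\<epsilon>>0. \<forall>z. \<epsilon> * (cmod z)\<^sup>2 \<le> plane_form P Q R z)"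
  proof
    assume "\<exists>\<epsilon>>0. \<forall>z. \<epsilon> * (cmod z)\<^sup>2 \<le> q z"
    then obtain \<epsilon> where "\<epsilon> > 0" and \<epsilon>: "\<And>z. \<epsilon> * (cmod z)\<^sup>2 \<le> q z" by blast
    have "2 * \<epsilon> * (cmod a)\<^sup>2 * (cmod z)\<^sup>2 \<le> plane_form P Q R z" for z
      using \<epsilon>[of "a * z"] \<open>a \<noteq> 0\<close> by (simp add: q_def norm_mult power_mult_distrib)
    with \<open>\<epsilon> > 0\<close> \<open>a \<noteq> 0\<close> show "\<exists>\<epsilon>>0. \<forall>z. \<epsilon> * (cmod z)\<^sup>2 \<le> plane_form P Q R z"
      by (intro exI[of _ "2 * \<epsilon> * (cmod a)\<^sup>2"]) auto
  next
    assume "\<exists>\<epsilon>>0. \<forall>z. \<epsilon> * (cmod z)\<^sup>2 \<le> plane_form P Q R z"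
    then obtain \<epsilon> where "\<epsilon> > 0" and \<epsilon>: "\<And>z. \<epsilon> * (cmod z)\<^sup>2 \<le> plane_form P Q R z" by blast
    have "\<epsilon> / 2 / (cmod a)\<^sup>2 * (cmod z)\<^sup>2 \<le> q z" for z
      using \<epsilon>[of "z / a"] by (simp add: q_def norm_divide power_divide)
    with \<open>\<epsilon> > 0\<close> \<open>a \<noteq> 0\<close> show "\<exists>\<epsilon>>0. \<forall>z. \<epsilon> * (cmod z)\<^sup>2 \<le> q z"
      by (intro exI[of _ "\<epsilon> / 2 / (cmod a)\<^sup>2"]) auto
  qed
  also have "\<dots> \<longleftrightarrow> cmod (Complex (P - R) (- 2 * Q)) < P + R"
    by (rule plane_form_pos_iff[symmetric])
  finally have pos: "(\<exists>\<epsilon>>0. \<forall>z. \<epsilon> * (cmod z)\<^sup>2 \<le> q z) \<longleftrightarrow> cmod (Complex (P - R) (- 2 * Q)) < P + R" .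
  have "((\<lambda>z. (z, 0)) \<longlongrightarrow> (0, 0 :: complex)) (at (0 :: complex))"
    by (intro tendsto_intros)
  then have evW: "\<forall>\<^sub>F z in at 0. (z, 0) \<in> W"
    using W(1,2) by (intro topological_tendstoD) (auto simp: zero_prod_def)
  \<comment> \<open>For small \<open>z\<close> the point \<open>(z, 0)\<close> lies in
    \<open>W\<close>, where the complex Hessian is the real number \<open>F (z, 0)\<close>.\<close>
  have rhs: "(\<forall>\<^sub>F z in at 0. hess (cplx r) L L (z, 0) \<ge> complex_of_real (\<epsilon> * (cmod z)\<^sup>2 + g z))
      \<longleftrightarrow> (\<forall>\<^sub>F z in at 0. \<epsilon> * (cmod z)\<^sup>2 + g z \<le> F (z, 0))" for \<epsilon> g
    by (rule eventually_cong[OF evW]) (simp only: hess_F, simp add: less_eq_complex_def)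
  show ?thesis
    unfolding rhs lower pos lhs[unfolded S_def] ..
qed

end
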